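(* Let $\dot x=A(t)x$ be a linear system with $A:[0,\infty)\to\mathbb{R}^{d\times d}$ continuous and bounded. If the system is regular, has simple Lyapunov spectrum, and is $L$-dimensionally strongly fast invertible for every $L=1,\dots,d$, then there exist a fundamental matrix $X(t)=[x_1(t),\dots,x_d(t)]$ and a constant $b>0$ such that $$\frac{\|x_i(t)\|}{\|x_i(s)\|}\ \geq\ b\,\frac{\|x_{i+1}(t)\|}{\|x_{i+1}(s)\|}$$ for all $t\geq s\ge 0$ and $i=1,\dots,d-1$.
   Context: Norms are Euclidean norms. $X(t)$ denotes a fundamental matrix of $\dot x=A(t)x$ and $X(t,s)=X(t)X(s)^{-1}$, $t\ge s\ge0$, the Cauchy matrix. Characteristic exponent of a solution $x$: $\chi[x]=\limsup_{t\to\infty}\frac1t\log\|x(t)\|$. The Lyapunov exponents $\lambda_1>\dots>\lambda_p$ are the distinct values of $\chi[x]$ over non-trivial solutions. With $V_i=\{x \text{ solution}: \chi[x]\le\lambda_i\}$ and $V_{p+1}=\{0\}$, the multiplicity of $\lambda_i$ is $d_i=\dim V_i-\dim V_{i+1}$. The Lyapunov spectrum is simple if $d_i=1$ for all $i$ (so $p=d$). The system is called regular if $\sum_{i=1}^p d_i\lambda_i=\liminf_{t\to\infty}\frac1t\log|\det X(t)|$. The system is called $L$-dimensionally strongly fast invertible ($1\le L\le d$) if $$\sup_{t\ge s\ge\tau\ge 0}\ \prod_{k=1}^L\frac{\sigma_k(X(t,s))\,\sigma_k(X(s,\tau))}{\sigma_k(X(t,\tau))}<\infty,$$ where $\sigma_1\ge\dots\ge\sigma_d$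 denote singular values. *)

theory Defs
  imports
    "HOL-Analysis.Analysis"
    "HOL-Computational_Algebra.Polynomial"
    "HOL-Library.Function_Algebras"
begin

(* Singular values: the square roots of the eigenvalues of A^T A, counted with their
   multiplicity as roots of the characteristic polynomial, in decreasing order.
   The first one is singular_value 1 A, the last one singular_value CARD('n) A. *)

definition charpoly :: "real^'n^'n \<Rightarrow> real poly" where
  "charpoly M = det (\<chi> i j. (if i = j then [:0, 1:] else 0) - [:M $ i $ j:])"

definition singular_values :: "real^'n^'n \<Rightarrow> real list" where
  "singular_values A =
     rev (sorted_list_of_multiset (image_mset sqrt (proots (charpoly (transpose A ** A)))))"

definition singular_value :: "nat \<Rightarrow> real^'n^'n \<Rightarrow> real" where
  "singular_value k A = singular_values A ! (k - 1)"

(* A function on [0,\<infinity>) is represented by its extension by 0 to the negative reals, so that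
   the solutions of x' = A(t) x form a finite-dimensional space of functions. *)

definition solutions :: "(real \<Rightarrow> real^'n^'n) \<Rightarrow> (real \<Rightarrow> real^'n) set" where
  "solutions A = {x. (\<forall>t\<ge>0. (x has_vector_derivative A t *v x t) (at t within {0..})) \<and>
                     (\<forall>t<0. x t = 0)}"

global_interpretation fun_vs:
  vector_space "\<lambda>(c::real) (f :: real \<Rightarrow> 'a::real_vector) t. c *\<^sub>R f t"
  by standard (auto simp: fun_eq_iff scaleR_add_right scaleR_add_left)

definition fundamental_matrix ::
  "(real \<Rightarrow> real^'n^'n) \<Rightarrow> (real \<Rightarrow> real^'n^'n) \<Rightarrow> bool" where
  "fundamental_matrix A X \<longleftrightarrow>
     (\<forall>t\<ge>0. (X has_vector_derivative A t ** X t) (at t within {0..})) \<and>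
     (\<forall>t\<ge>0. invertible (X t))"

definition cauchy_matrix :: "(real \<Rightarrow> real^'n^'n) \<Rightarrow> real \<Rightarrow> real \<Rightarrow> real^'n^'n" where
  "cauchy_matrix X t s = X t ** matrix_inv (X s)"

(* The logarithm with log 0 = -\<infinity> (whereas ln 0 = 0 in the library), so that the
   characteristic exponent of the zero solution is -\<infinity>. *)

definition elog :: "real \<Rightarrow> ereal" where
  "elog r = (if r = 0 then -\<infinity> else ereal (ln r))"

definition char_exponent :: "(real \<Rightarrow> real^'n) \<Rightarrow> ereal" where
  "char_exponent x = Limsup at_top (\<lambda>t. elog (norm (x t)) / ereal t)"

(* The distinct exponents in decreasing order. When A is bounded, this is a list of
   finitely many (at most CARD('n)) finite values. *)

definition lyapunov_exponents :: "(real \<Rightarrow> real^'n^'n) \<Rightarrow> ereal list" where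
  "lyapunov_exponents A = rev (sorted_list_of_set (char_exponent ` (solutions A - {0})))"

definition lyapunov_exponent :: "(real \<Rightarrow> real^'n^'n) \<Rightarrow> nat \<Rightarrow> ereal" where
  "lyapunov_exponent A i = lyapunov_exponents A ! (i - 1)"

(* V_i for i = 1, ..., p + 1, where p is the number of distinct exponents *)

definition lyapunov_space :: "(real \<Rightarrow> real^'n^'n) \<Rightarrow> nat \<Rightarrow> (real \<Rightarrow> real^'n) set" where
  "lyapunov_space A i =
     (if i \<le> length (lyapunov_exponents A)
      then {x \<in> solutions A. char_exponent x \<le> lyapunov_exponent A i} else {0})"

definition lyapunov_mult :: "(real \<Rightarrow> real^'n^'n) \<Rightarrow> nat \<Rightarrow> nat" where
  "lyapunov_mult A i =
     fun_vs.dim (lyapunov_space A i) - fun_vs.dim (lyapunov_space A (Suc i))"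

definition simple_spectrum :: "(real \<Rightarrow> real^'n^'n) \<Rightarrow> bool" where
  "simple_spectrum A \<longleftrightarrow> (\<forall>i\<in>{1..length (lyapunov_exponents A)}. lyapunov_mult A i = 1)"

(* In the next two definitions the choice of the fundamental matrix X is immaterial: two of
   them differ by a constant invertible right factor, which changes neither the lower limit
   of log |det X(t)| / t nor the Cauchy matrix. *)

definition regular_system :: "(real \<Rightarrow> real^'n^'n) \<Rightarrow> bool" where
  "regular_system A \<longleftrightarrow>
     (\<exists>X. fundamental_matrix A X \<and>
       (\<Sum>i = 1..length (lyapunov_exponents A).
          ereal (real (lyapunov_mult A i)) * lyapunov_exponent A i) =
       Liminf at_top (\<lambda>t. elog \<bar>det (X t)\<bar> / ereal t))"

definition strongly_fast_invertible :: "(real \<Rightarrow> real^'n^'n) \<Rightarrow> nat \<Rightarrow> bool" where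
  "strongly_fast_invertible A L \<longleftrightarrow>
     (\<exists>X. fundamental_matrix A X \<and>
       bdd_above {(\<Prod>k = 1..L.
           singular_value k (cauchy_matrix X t s) * singular_value k (cauchy_matrix X s \<tau>)
             / singular_value k (cauchy_matrix X t \<tau>)) | t s \<tau>. t \<ge> s \<and> s \<ge> \<tau> \<and> \<tau> \<ge> 0})"

end

theory Submission
  imports Defs
begin

text \<open>Let \<open>P_L(M)\<close> be the product of the \<open>L\<close> largest singular values of \<open>M\<close>, and let \<open>y_L(t)\<close> be the
  volume spanned at time \<open>t\<close> by solutions \<open>x_1, \<dots>, x_L\<close>, where \<open>x_1, \<dots>, x_d\<close> is a basis such that
  the exponent of \<open>x_i\<close> is the \<open>i\<close>-th Lyapunov exponent. As the spectrum is simple, the exponents of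
  all other exterior products of \<open>L\<close> of these solutions are smaller than that of \<open>y_L\<close>, which
  is \<open>\<lambda>_1 + \<dots> + \<lambda>_L\<close> by regularity. Hence \<open>P_L(X(t,0))\<close> is bounded by a multiple of \<open>y_L(t)\<close>, and
  strong fast invertibility turns this into \<open>y_L(t) / y_L(s) \<approx> P_L(X(t,s))\<close> for \<open>t \<ge> s \<ge> 0\<close>.

  The angle between \<open>x_L(t)\<close> and the span of \<open>x_1(t), \<dots>, x_{L-1}(t)\<close> is bounded below: \<open>X(T,t)\<close>
  expands the volume \<open>y_{L-1}\<close> almost as much as possible, while \<open>x_L\<close> is negligible at time \<open>T\<close>
  compared with \<open>\<sigma>_{L-1}(X(T,t))\<close> as \<open>T \<rightarrow> \<infinity>\<close>. Therefore \<open>|x_L(t)| \<approx> y_L(t) / y_{L-1}(t)\<close>, so that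
  \<open>|x_L(t)| / |x_L(s)| \<approx> \<sigma>_L(X(t,s))\<close>, and the claim follows from \<open>\<sigma>_i \<ge> \<sigma>_{i+1}\<close>.\<close>

text \<open>Regularity enters only through the determinant: by Hadamard's inequality |det Y(t)| is
  at most a multiple of y_L(t) times the lengths of the other columns. Their exponents bound these
  lengths from above, so a lower bound for det becomes one for y_L. Strong fast invertibility is
  applied from time 0, where P_L(X(s,0)) is at least a multiple of y_L(s) and P_L(X(t,0)) at most a
  multiple of y_L(t). The converse y_L(t) <= C P_L(X(t,s)) y_L(s) is a general fact about matrices.
  The angle bound must be uniform in t, although exponents say nothing uniform about [t,T]. Its
  error term is |x_L(T)| / sigma_{L-1}(X(T,t)), and 1 / sigma_{L-1} = P_{L-2} / P_{L-1} bounds it by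
  a factor depending on t times |x_L(T)| y_{L-2}(T) / y_{L-1}(T). This quotient tends to 0 because
  lambda_L < lambda_{L-1}. For fixed t the error thus disappears as T tends to infinity, however
  large the factor, and the surviving constant is free of t.\<close>

section \<open>Minors\<close>

text \<open>The minor of \<open>W\<close> with rows \<open>h ` S\<close> and columns \<open>g ` S\<close>, padded by the identity matrix outside \<open>S\<close>
  because \<open>det\<close> needs an index type.\<close>

definition minor :: "'n set \<Rightarrow> ('n \<Rightarrow> 'n) \<Rightarrow> ('n \<Rightarrow> 'n) \<Rightarrow> real^'n^'n \<Rightarrow> real" where
  "minor S h g W =
     det (\<chi> a b. if a \<in> S \<and> b \<in> S then W $ h a $ g b else if a = b then 1 else 0)"

definition diag :: "('n \<Rightarrow> real) \<Rightarrow> real^'n^'n" where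
  "diag \<sigma> = (\<chi> i j. if i = j then \<sigma> i else 0)"

lemma minor_transpose: "minor S h g (transpose W) = minor S g h W"
proof -
  have "minor S g h W = det (transpose (\<chi> a b. if a \<in> S \<and> b \<in> S then W $ g a $ h b
            else if a = b then 1 else 0))"
    by (simp add: minor_def)
  also have "\<dots> = minor S h g (transpose W)"
    unfolding minor_def by (rule arg_cong[where f = det]) (auto simp: vec_eq_iff transpose_def)
  finally show ?thesis by simp
qed

lemma minor_UNIV_id: "minor UNIV id id W = det W"
  unfolding minor_def by simp

lemma minor_empty [simp]: "minor {} h g W = 1"
proof -
  have "minor {} h g W = det (mat 1 :: real^'a^'a)"
    unfolding minor_def by (rule arg_cong[where f = det]) (auto simp: vec_eq_iff mat_def)
  then show ?thesis by simp
qed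

lemma minor_mat_1 [simp]: "minor S id id (mat 1) = 1"
proof -
  have "minor S id id (mat 1) = det (mat 1 :: real^'a^'a)"
    unfolding minor_def by (rule arg_cong[where f = det]) (auto simp: vec_eq_iff mat_def)
  then show ?thesis by simp
qed

lemma minor_cong:
  assumes "\<And>a. a \<in> S \<Longrightarrow> h a = h' a" "\<And>a. a \<in> S \<Longrightarrow> g a = g' a"
  shows "minor S h g W = minor S h' g' W"
  unfolding minor_def using assms
  by (intro arg_cong[where f = det]) (auto simp: vec_eq_iff)

text \<open>Cauchy-Binet in an unsorted form: each row of the product is a combination of rows of
  \<open>W\<close>, and multilinearity of \<open>det\<close> yields one term per row choice
  \<open>f\<close>. A padded row is a unit vector, so \<open>f\<close> has to fix its index.\<close>

lemma minor_mult_left: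
  fixes M W :: "real^'n^'n"
  shows "minor S h g (M ** W) =
     (\<Sum>f\<in>UNIV. (\<Prod>a\<in>UNIV. if a \<in> S then M $ h a $ f a else if f a = a then 1 else 0)
        * minor S f g W)"
proof -
  define R :: "'n \<Rightarrow> 'n \<Rightarrow> real^'n" where
    "R a i = (\<chi> b. if a \<in> S \<and> b \<in> S then W $ i $ g b else if a = b then 1 else 0)" for a i
  define c where "c a i = (if a \<in> S then M $ h a $ i else if i = a then 1 else 0)" for a i
  have row: "(\<chi> b. if a \<in> S \<and> b \<in> S then (M ** W) $ h a $ g b else if a = b then 1 else 0) =
      (\<Sum>i\<in>UNIV. c a i *s R a i)" for a
  proof (cases "a \<in> S")
    case True
    then show ?thesis
      by (auto simp: vec_eq_iff c_def R_def matrix_matrix_mult_def intro!: sum.neutral)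
  next
    case False
    then have "c a i *s R a i = (if i = a then R a i else 0)" for i
      by (auto simp: c_def)
    with False show ?thesis by (simp add: R_def)
  qed
  have "minor S h g (M ** W) = det (\<chi> a. \<Sum>i\<in>UNIV. c a i *s R a i)"
    unfolding minor_def by (simp only: row flip: row)
  also have "\<dots> = (\<Sum>f\<in>UNIV. det (\<chi> a. c a (f a) *s R a (f a)))"
    by (subst det_linear_rows_sum) auto
  also have "\<dots> = (\<Sum>f\<in>UNIV. (\<Prod>a\<in>UNIV. c a (f a)) * minor S f g W)"
    by (simp add: det_rows_mul minor_def R_def)
  finally show ?thesis by (simp add: c_def)
qed

text \<open>Each coefficient of the expansion has \<open>CARD('n)\<close> factors;
  \<open>m \<ge> 1\<close> covers the factors 0 and 1 of the padded rows.\<close>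

lemma minor_mult_left_le:
  fixes M W :: "real^'n^'n"
  assumes "\<And>i j. \<bar>M $ i $ j\<bar> \<le> m" "m \<ge> 1"
  shows "\<bar>minor S h g (M ** W)\<bar> \<le> m ^ CARD('n) * (\<Sum>f\<in>UNIV. \<bar>minor S f g W\<bar>)"
proof -
  have le: "\<bar>\<Prod>a\<in>UNIV. if a \<in> S then M $ h a $ f a else if f a = a then 1 else 0\<bar> \<le> m ^ CARD('n)"
    for f
  proof -
    have "\<bar>\<Prod>a\<in>UNIV. if a \<in> S then M $ h a $ f a else if f a = a then 1 else 0\<bar>
        \<le> (\<Prod>a\<in>(UNIV :: 'n set). m)"
      unfolding abs_prod using assms by (intro prod_mono) auto
    then show ?thesis by simp
  qed
  have "\<bar>minor S h g (M ** W)\<bar> \<le> (\<Sum>f\<in>UNIV. m ^ CARD('n) * \<bar>minor S f g W\<bar>)"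
    unfolding minor_mult_left
    by (intro order_trans[OF sum_abs] sum_mono) (auto simp: abs_mult intro!: mult_right_mono le)
  then show ?thesis by (simp add: sum_distrib_left)
qed

lemma minor_diag_mult:
  "minor S h g (diag \<sigma> ** W) = (\<Prod>a\<in>S. \<sigma> (h a)) * minor S h g W"
proof -
  have *: "(diag \<sigma> ** W) $ i $ j = \<sigma> i * W $ i $ j" for i j
    by (simp add: matrix_matrix_mult_def diag_def if_distrib[where f = "\<lambda>x. x * _"] cong: if_cong)
  have "minor S h g (diag \<sigma> ** W) = det (\<chi> a. (if a \<in> S then \<sigma> (h a) else 1) *s
     (\<chi> b. if a \<in> S \<and> b \<in> S then W $ h a $ g b else if a = b then 1 else 0))"
    unfolding minor_def by (rule arg_cong[where f = det]) (auto simp: vec_eq_iff *)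
  also have "\<dots> = (\<Prod>a\<in>UNIV. if a \<in> S then \<sigma> (h a) else 1) * minor S h g W"
    by (simp add: det_rows_mul minor_def)
  also have "(\<Prod>a\<in>UNIV. if a \<in> S then \<sigma> (h a) else 1) = (\<Prod>a\<in>S. \<sigma> (h a))"
    by (simp add: prod.If_cases)
  finally show ?thesis .
qed

lemma minor_not_inj_rows:
  assumes "\<not> inj_on h S"
  shows "minor S h g W = 0"
proof -
  from assms obtain a b where "a \<in> S" "b \<in> S" "a \<noteq> b" "h a = h b"
    by (auto simp: inj_on_def)
  then show ?thesis
    unfolding minor_def by (intro det_identical_rows[of a b]) (auto simp: row_def vec_eq_iff)
qed

lemma minor_not_inj_cols: "\<not> inj_on g S \<Longrightarrow> minor S h g W = 0"
  by (metis minor_not_inj_rows minor_transpose)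

lemma abs_minor_permuted_rows:
  assumes "p permutes S"
  shows "\<bar>minor S (h \<circ> p) g W\<bar> = \<bar>minor S h g W\<bar>"
proof -
  define B where "B = (\<chi> a b. if a \<in> S \<and> b \<in> S then W $ h a $ g b else if a = b then 1 else 0)"
  have "minor S (h \<circ> p) g W = det (\<chi> a. B $ p a)"
    unfolding minor_def B_def using assms
    by (intro arg_cong[where f = det])
       (auto simp: vec_eq_iff permutes_in_image permutes_not_in)
  also have "\<dots> = of_int (sign p) * minor S h g W"
    using det_permute_rows[OF permutes_subset[OF assms subset_UNIV], of B]
    by (simp only: B_def minor_def)
  finally show ?thesis by (simp add: abs_mult sign_def)
qed

lemma abs_minor_permuted_cols:
  "p permutes S \<Longrightarrow> \<bar>minor S h (g \<circ> p) W\<bar> = \<bar>minor S h g W\<bar>"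
  by (metis abs_minor_permuted_rows minor_transpose)

text \<open>In the Leibniz sum only permutations fixing \<open>l\<close> survive, and these never
  pick column \<open>l\<close> in another row. Erasing that column makes row and column
  \<open>l\<close> look like padding.\<close>

lemma det_unit_row:
  fixes R :: "'n::finite \<Rightarrow> real^'n"
  shows "det (\<chi> a. if a = l then axis l 1 else R a) =
    det (\<chi> a. if a = l then axis l 1 else (\<chi> c. if c = l then 0 else R a $ c))"
proof -
  have "(\<Prod>i\<in>UNIV. (\<chi> a. if a = l then axis l 1 else R a) $ i $ p i) =
      (\<Prod>i\<in>UNIV. (\<chi> a. if a = l then axis l 1 else (\<chi> c. if c = l then 0 else R a $ c)) $ i $ p i)"
    if "p permutes UNIV" for p
  proof (cases "p l = l")
    case True
    have "p i \<noteq> l" if "i \<noteq> l" for i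
      using True that \<open>p permutes UNIV\<close> by (metis permutes_def)
    then show ?thesis by (intro prod.cong) auto
  next
    case False
    then show ?thesis
      by (subst (1 2) prod.remove[of UNIV l]) (auto simp: axis_def)
  qed
  then show ?thesis
    unfolding det_def by (intro sum.cong refl arg_cong2[where f = times]) auto
qed

text \<open>Laplace expansion along the new row. Without an index order there are no alternating
  signs; instead column \<open>b\<close> is exchanged with column \<open>l\<close>, which costs one
  transposition for every \<open>b \<noteq> l\<close> and leaves \<open>g l\<close> in place
  \<open>b\<close>.\<close>

lemma minor_insert_row:
  fixes W :: "real^'n^'n"
  assumes "l \<notin> S"
  shows "minor (insert l S) h g W =
    (\<Sum>b\<in>insert l S. (if b = l then 1 else -1) * W $ h l $ g b * minor S h (g(b := g l)) W)"
proof -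
  define R :: "'n \<Rightarrow> real^'n" where
    "R a = (\<chi> c. if a \<in> S \<and> c \<in> insert l S then W $ h a $ g c else if a = c then 1 else 0)" for a
  have unit: "det (\<chi> a. if a = l then axis b 1 else R a) =
      (if b = l then 1 else -1) * minor S h (g(b := g l)) W" if b: "b \<in> insert l S" for b
  proof -
    let ?p = "Transposition.transpose b l"
    let ?B = "\<chi> a. if a = l then axis b 1 else R a"
    have "det (\<chi> i j. ?B $ i $ ?p j) = of_int (sign ?p) * det ?B"
      by (rule det_permute_columns) (simp add: permutes_swap_id)
    also have "(\<chi> i j. ?B $ i $ ?p j) =
        (\<chi> a. if a = l then axis l 1 else (\<chi> c. R a $ ?p c))"
      by (auto simp: vec_eq_iff axis_def Transposition.transpose_def)
    also have "det \<dots> = det (\<chi> a. if a = l then axis l 1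
        else (\<chi> c. if c = l then 0 else (\<chi> c. R a $ ?p c) $ c))"
      by (rule det_unit_row)
    also have "\<dots> = minor S h (g(b := g l)) W"
      unfolding minor_def using assms b
      by (intro arg_cong[where f = det])
         (auto simp: vec_eq_iff axis_def R_def Transposition.transpose_def)
    finally show ?thesis by (auto simp: sign_swap_id)
  qed
  have rowl: "(\<chi> c. if c \<in> insert l S then W $ h l $ g c else 0) =
      (\<Sum>b\<in>insert l S. W $ h l $ g b *s axis b 1)"
    by (auto simp: vec_eq_iff axis_def if_distrib cong: if_cong)
  have "minor (insert l S) h g W =
      det (\<chi> a. if a = l then (\<Sum>b\<in>insert l S. W $ h l $ g b *s axis b 1) else R a)"
    unfolding minor_def rowl[symmetric]
    by (intro arg_cong[where f = det]) (auto simp: vec_eq_iff R_def)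
  also have "\<dots> = (\<Sum>b\<in>insert l S. det (\<chi> a. if a = l then W $ h l $ g b *s axis b 1 else R a))"
    by (rule det_linear_row_sum) simp
  also have "\<dots> = (\<Sum>b\<in>insert l S. W $ h l $ g b * det (\<chi> a. if a = l then axis b 1 else R a))"
    by (simp only: det_row_mul)
  also have "\<dots> =
      (\<Sum>b\<in>insert l S. (if b = l then 1 else -1) * W $ h l $ g b * minor S h (g(b := g l)) W)"
    by (intro sum.cong refl) (subst unit, auto)
  finally show ?thesis .
qed

lemma minor_insert_col:
  fixes W :: "real^'n^'n"
  assumes "l \<notin> S"
  shows "minor (insert l S) h g W =
    (\<Sum>a\<in>insert l S. (if a = l then 1 else -1) * W $ h a $ g l * minor S (h(a := h l)) g W)"
  using minor_insert_row[OF assms, of g h "transpose W"]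
  by (simp add: minor_transpose) (simp add: transpose_def)

section \<open>Singular value decomposition\<close>

text \<open>First-variation argument for the Rayleigh quotient: a nonzero linear term beats the
  quadratic one for small \<open>r\<close> of its own sign. The violating value is
  \<open>r = b / K\<close>.\<close>

lemma linear_le_quadratic_imp_zero:
  fixes b c :: real
  assumes "\<And>r. r * b \<le> r\<^sup>2 * c"
  shows "b = 0"
proof (rule ccontr)
  assume b: "b \<noteq> 0"
  define K where "K = \<bar>c\<bar> + 1"
  have K: "K > 0" "c < K" by (auto simp: K_def)
  have "b / K * b \<le> (b / K)\<^sup>2 * c" by (rule assms)
  also have "\<dots> < (b / K)\<^sup>2 * K"
    using b K by (intro mult_strict_left_mono) auto
  also have "\<dots> = b / K * b"
    using K by (simp add: power2_eq_square field_simps)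
  finally show False by simp
qed

text \<open>The eigenvector is a maximizer of the Rayleigh quotient.\<close>

lemma selfadjoint_eigenvector_exists:
  fixes f :: "'a::euclidean_space \<Rightarrow> 'a"
  assumes f: "linear f" "\<And>x y. f x \<bullet> y = x \<bullet> f y"
    and S: "subspace S" "f ` S \<subseteq> S" "S \<noteq> {0}"
  shows "\<exists>v\<in>S. norm v = 1 \<and> (\<exists>\<mu>. f v = \<mu> *\<^sub>R v)"
proof -
  let ?K = "S \<inter> sphere 0 1"
  have "compact ?K"
    using closed_Int_compact[OF closed_subspace[OF S(1)] compact_sphere] .
  moreover obtain w where w: "w \<in> S" "w \<noteq> 0"
    using S(1,3) subspace_0 by fastforce
  then have "w /\<^sub>R norm w \<in> ?K"
    using S(1) by (auto intro: subspace_mul)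
  moreover have "continuous_on ?K (\<lambda>x. x \<bullet> f x)"
    using linear_continuous_on[OF linear_conv_bounded_linear[THEN iffD1, OF f(1)]]
    by (intro continuous_intros)
  ultimately obtain v where v: "v \<in> ?K" and max: "\<And>y. y \<in> ?K \<Longrightarrow> y \<bullet> f y \<le> v \<bullet> f v"
    using continuous_attains_sup[of ?K "\<lambda>x. x \<bullet> f x"] by blast
  define \<mu> where "\<mu> = v \<bullet> f v"
  have vS: "v \<in> S" and vv: "v \<bullet> v = 1"
    using v by (auto simp: norm_eq_1)
  have max': "y \<bullet> f y \<le> \<mu> * (y \<bullet> y)" if "y \<in> S" for y
  proof (cases "y = 0")
    case True
    then show ?thesis by simp
  next
    case False
    have "y /\<^sub>R norm y \<in> ?K"
      using S(1) that False by (auto intro: subspace_mul)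
    from max[OF this] have "(y /\<^sub>R norm y) \<bullet> f (y /\<^sub>R norm y) \<le> \<mu>"
      unfolding \<mu>_def .
    then have "(y \<bullet> f y) / (norm y)\<^sup>2 \<le> \<mu>"
      unfolding linear_scale[OF f(1)] by (simp add: power2_eq_square divide_inverse mult_ac)
    then show ?thesis
      using False by (simp add: field_simps power2_norm_eq_inner)
  qed
  \<comment> \<open>Moving from \<open>v\<close> in direction \<open>w\<close> cannot increase the
    Rayleigh quotient, so the term linear in \<open>r\<close> vanishes.\<close>
  have orth: "w \<bullet> f v = 0" if w: "w \<in> S" "v \<bullet> w = 0" for w
  proof -
    have "r * (2 * (w \<bullet> f v)) \<le> r\<^sup>2 * (\<mu> * (w \<bullet> w) - w \<bullet> f w)" for r
    proof -
      have "(v + r *\<^sub>R w) \<bullet> f (v + r *\<^sub>R w) \<le> \<mu> * ((v + r *\<^sub>R w) \<bullet> (v + r *\<^sub>R w))"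
        using S(1) w vS by (intro max') (auto intro: subspace_add subspace_mul)
      moreover have "v \<bullet> f w = w \<bullet> f v"
        using f(2) by (metis inner_commute)
      ultimately show ?thesis
        using w(2) vv by (simp add: linear_add[OF f(1)] linear_scale[OF f(1)] inner_add_left
            inner_add_right inner_commute[of w v] \<mu>_def[symmetric] algebra_simps power2_eq_square)
    qed
    then have "2 * (w \<bullet> f v) = 0"
      by (rule linear_le_quadratic_imp_zero)
    then show ?thesis by simp
  qed
  \<comment> \<open>The residual lies in \<open>S\<close> and is orthogonal to both \<open>v\<close>
    and \<open>f v\<close>, hence to itself.\<close>
  define z where "z = f v - \<mu> *\<^sub>R v"
  have "z \<in> S"
    unfolding z_def using S vS by (intro subspace_diff subspace_mul) auto
  moreover have vz: "v \<bullet> z = 0"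
    by (simp add: z_def inner_diff_right vv \<mu>_def)
  ultimately have "z \<bullet> f v = 0"
    by (rule orth)
  have "z \<bullet> z = z \<bullet> (f v - \<mu> *\<^sub>R v)"
    by (simp only: z_def)
  also have "\<dots> = 0"
    using \<open>z \<bullet> f v = 0\<close> vz by (simp add: inner_diff_right inner_commute[of z v])
  finally have "z = 0" by simp
  then have "f v = \<mu> *\<^sub>R v" by (simp add: z_def)
  then show ?thesis using v by auto
qed

text \<open>Induction on the dimension of an invariant subspace: self-adjointness makes the
  orthogonal complement of an eigenvector invariant again.\<close>

lemma selfadjoint_orthonormal_eigenbasis:
  fixes f :: "'a::euclidean_space \<Rightarrow> 'a"
  assumes f: "linear f" "\<And>x y. f x \<bullet> y = x \<bullet> f y"
    and S: "subspace S" "f ` S \<subseteq> S"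
  shows "\<exists>B. finite B \<and> card B = dim S \<and> B \<subseteq> S \<and> pairwise orthogonal B \<and>
     (\<forall>b\<in>B. norm b = 1 \<and> (\<exists>\<mu>. f b = \<mu> *\<^sub>R b))"
  using S
proof (induction "dim S" arbitrary: S)
  case 0
  then show ?case by (intro exI[of _ "{}"]) auto
next
  case (Suc n)
  then have "S \<noteq> {0}" by auto
  then obtain v \<mu> where v: "v \<in> S" "norm v = 1" "f v = \<mu> *\<^sub>R v"
    using selfadjoint_eigenvector_exists[OF f Suc.prems] by blast
  define T where "T = {x \<in> S. orthogonal v x}"
  have T: "subspace T"
    using Suc.prems(1) unfolding T_def
    by (auto simp: subspace_def orthogonal_def inner_add_right)
  have fT: "f ` T \<subseteq> T"
    using Suc.prems(2) v(3) unfolding T_def orthogonal_def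
    by (auto simp flip: f(2))
  have "dim T + dim (span {v}) = dim S"
  proof -
    have "span {v} \<subseteq> S"
      using v(1) Suc.prems(1) by (intro span_minimal) auto
    moreover have "T = {y \<in> S. \<forall>x\<in>span {v}. orthogonal x y}"
      unfolding T_def by (auto simp: span_singleton orthogonal_def intro: exI[of _ 1]
          dest: bspec[of _ _ "1 *\<^sub>R v"])
    ultimately show ?thesis
      using dim_subspace_orthogonal_to_vectors[of "span {v}" S] Suc.prems(1) by simp
  qed
  moreover have "dim (span {v}) = 1"
    using v(2) by (auto simp: dim_singleton)
  ultimately have dT: "n = dim T" using Suc.hyps(2) by simp
  from Suc.hyps(1)[OF dT T fT] obtain B where B: "finite B" "card B = dim T" "B \<subseteq> T"
    "pairwise orthogonal B" "\<forall>b\<in>B. norm b = 1 \<and> (\<exists>\<mu>. f b = \<mu> *\<^sub>R b)" by blast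
  have "v \<notin> B"
    using B(3) v(2) by (auto simp: T_def orthogonal_def)
  moreover have "\<And>b. b \<in> B \<Longrightarrow> orthogonal v b"
    using B(3) by (auto simp: T_def)
  ultimately show ?case
    using B v dT Suc.hyps(2)
    by (intro exI[of _ "insert v B"])
       (auto simp: pairwise_insert orthogonal_commute T_def)
qed

lemma matrix_diff_left: "(A - B) ** (C :: real^'n^'m) = A ** C - B ** C"
  by (simp add: matrix_matrix_mult_def vec_eq_iff sum_subtractf left_diff_distrib)

lemma matrix_diff_right: "(A :: real^'n^'m) ** (B - C) = A ** B - A ** C"
  by (simp add: matrix_matrix_mult_def vec_eq_iff sum_subtractf right_diff_distrib)

lemma orthogonal_eigenmatrix_exists:
  fixes B :: "real^'n^'n"
  assumes "transpose B = B"
  shows "\<exists>Q \<mu>. orthogonal_matrix Q \<and> B ** Q = Q ** diag \<mu>"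
proof -
  have "\<And>x y. (B *v x) \<bullet> y = x \<bullet> (B *v y)"
    using assms by (metis dot_lmul_matrix vector_transpose_matrix)
  from selfadjoint_orthonormal_eigenbasis[OF matrix_vector_mul_linear this subspace_UNIV]
  obtain E where E: "finite E" "card E = CARD('n)" "pairwise orthogonal E"
    "\<forall>b\<in>E. norm b = 1 \<and> (\<exists>\<mu>. B *v b = \<mu> *\<^sub>R b)"
    by auto
  then obtain \<phi> :: "'n \<Rightarrow> real^'n" where \<phi>: "bij_betw \<phi> UNIV E"
    using finite_same_card_bij[of "UNIV :: 'n set" E] by auto
  then have \<phi>E: "\<phi> i \<in> E" for i
    by (auto simp: bij_betw_def)
  then have "\<forall>i. \<exists>\<mu>. B *v \<phi> i = \<mu> *\<^sub>R \<phi> i"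
    using E(4) by blast
  then obtain \<mu> where \<mu>: "\<And>i. B *v \<phi> i = \<mu> i *\<^sub>R \<phi> i"
    by metis
  define Q where "Q = (\<chi> i j. \<phi> j $ i)"
  have col: "column j Q = \<phi> j" for j
    by (simp add: column_def Q_def vec_eq_iff)
  have "orthogonal_matrix Q"
    unfolding orthogonal_matrix_orthonormal_columns col
    using E(3,4) \<phi>E \<phi> unfolding pairwise_def bij_betw_def inj_on_def by blast
  moreover have "B ** Q = Q ** diag \<mu>"
  proof -
    have "(B ** Q) $ i $ j = (B *v \<phi> j) $ i" for i j
      by (simp add: matrix_matrix_mult_def matrix_vector_mult_def Q_def)
    moreover have "(Q ** diag \<mu>) $ i $ j = (\<mu> j *\<^sub>R \<phi> j) $ i" for i j
      by (simp add: matrix_matrix_mult_def diag_def Q_def if_distrib[where f = "\<lambda>x. _ * x"]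
          cong: if_cong)
    ultimately show ?thesis by (simp add: vec_eq_iff \<mu>)
  qed
  ultimately show ?thesis by blast
qed

section \<open>Singular values read off from a diagonalization\<close>

lemma poly_charpoly: "poly (charpoly M) x = det (mat x - M)"
proof -
  have "poly (charpoly M) x =
      det (\<chi> i j. poly ((if i = j then [:0, 1:] else 0) - [:M $ i $ j:]) x)"
    unfolding charpoly_def det_def
    by (simp add: poly_sum poly_prod)
  also have "(\<chi> i j. poly ((if i = j then [:0, 1:] else 0) - [:M $ i $ j:]) x) = mat x - M"
    by (auto simp: vec_eq_iff mat_def)
  finally show ?thesis .
qed

lemma det_diag: "det (diag \<sigma>) = prod \<sigma> UNIV"
  by (subst det_diagonal) (auto simp: diag_def)

text \<open>The polynomials are compared at each real \<open>x\<close>, where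
  \<open>charpoly\<close> becomes a real determinant and \<open>det Q\<close> cancels.\<close>

lemma charpoly_eigenmatrix:
  fixes B :: "real^'n^'n"
  assumes Q: "orthogonal_matrix Q" and BQ: "B ** Q = Q ** diag \<mu>"
  shows "charpoly B = (\<Prod>i\<in>UNIV. [:- \<mu> i, 1:])"
proof -
  have "poly (charpoly B) x = poly (\<Prod>i\<in>UNIV. [:- \<mu> i, 1:]) x" for x
  proof -
    have "(mat x - B) ** Q = Q ** diag (\<lambda>i. x - \<mu> i)"
    proof -
      have "diag (\<lambda>i. x - \<mu> i) = mat x - diag \<mu>"
        by (auto simp: diag_def mat_def vec_eq_iff)
      moreover have "mat x ** Q = Q ** mat x"
        by (auto simp: vec_eq_iff matrix_matrix_mult_def mat_def if_distrib
            if_distribR cong: if_cong)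
      ultimately show ?thesis
        using BQ by (simp add: matrix_diff_left matrix_diff_right)
    qed
    then have "det (mat x - B) * det Q = det Q * (\<Prod>i\<in>UNIV. x - \<mu> i)"
      by (metis det_mul det_diag)
    moreover have "det Q \<noteq> 0"
      using det_orthogonal_matrix[OF Q] by auto
    ultimately show ?thesis
      by (simp add: poly_charpoly poly_prod)
  qed
  then show ?thesis by (simp add: poly_eq_poly_eq_iff[symmetric] fun_eq_iff)
qed

lemma singular_values_eigenmatrix:
  fixes M :: "real^'n^'n"
  assumes "orthogonal_matrix Q" and "transpose M ** M ** Q = Q ** diag \<mu>"
  shows "singular_values M =
    rev (sorted_list_of_multiset (image_mset (\<lambda>i. sqrt (\<mu> i)) (mset_set UNIV)))"
proof -
  have "proots (charpoly (transpose M ** M)) = (\<Sum>i\<in>UNIV. proots [:- \<mu> i, 1:])"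
    unfolding charpoly_eigenmatrix[OF assms] by (rule proots_prod) auto
  also have "\<dots> = image_mset \<mu> (mset_set UNIV)"
    by (simp add: sum_unfold_sum_mset)
  finally show ?thesis
    by (simp add: singular_values_def image_mset.compositionality comp_def)
qed

text \<open>Indices are sorted instead of values, so that the eigenvectors can be permuted along
  with their singular values.\<close>

lemma sorted_enumeration_by_key:
  fixes k :: "'n::finite \<Rightarrow> real"
  obtains ys where "distinct ys" "set ys = UNIV"
    "map k ys = rev (sorted_list_of_multiset (image_mset k (mset_set UNIV)))"
proof -
  obtain us :: "'n list" where us: "set us = UNIV" "distinct us"
    using finite_distinct_list[of "UNIV :: 'n set"] by auto
  have "sorted_list_of_multiset (image_mset k (mset_set UNIV)) = map k (sort_key k us)"
  proof (rule properties_for_sort[symmetric, of _ "sorted_list_of_multiset _",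
        unfolded sorted_sort_id[OF sorted_sorted_list_of_multiset], symmetric])
  qed (use us mset_set_set[of us] in auto)
  then show ?thesis
    using us by (intro that[of "rev (sort_key k us)"]) (auto simp: rev_map)
qed

lemma diag_mult_diag: "diag a ** diag b = diag (\<lambda>i. a i * b i)"
  by (auto simp: diag_def matrix_matrix_mult_def vec_eq_iff if_distrib[where f = "\<lambda>x. x * _"]
      cong: if_cong)

lemma diag_1: "diag (\<lambda>_. 1) = mat 1"
  by (simp add: diag_def mat_def)

lemma transpose_diag: "transpose (diag a) = diag a"
  by (auto simp: diag_def transpose_def vec_eq_iff)

text \<open>With \<open>V\<close> diagonalizing \<open>transpose M ** M\<close>, the columns of
  \<open>W = M ** V\<close> are orthogonal, of lengths \<open>\<sigma> a\<close>. Invertibility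
  makes them nonzero, and normalizing them gives \<open>U\<close>.\<close>

lemma singular_value_decomposition:
  fixes M :: "real^'n^'n" and e :: "nat \<Rightarrow> 'n"
  assumes M: "invertible M" and e: "bij_betw e {1..CARD('n)} UNIV"
  obtains U V \<sigma> where "orthogonal_matrix U" "orthogonal_matrix V"
    "M = U ** diag \<sigma> ** transpose V" "\<And>a. \<sigma> a > 0"
    "\<And>k. k \<in> {1..CARD('n)} \<Longrightarrow> \<sigma> (e k) = singular_value k M"
    "\<And>k l. 1 \<le> k \<Longrightarrow> k \<le> l \<Longrightarrow> l \<le> CARD('n) \<Longrightarrow> \<sigma> (e l) \<le> \<sigma> (e k)"
proof -
  have "transpose (transpose M ** M) = transpose M ** M"
    by (simp add: matrix_transpose_mul)
  then obtain Q \<nu> where Q: "orthogonal_matrix Q" "transpose M ** M ** Q = Q ** diag \<nu>"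
    using orthogonal_eigenmatrix_exists by blast
  obtain ys :: "'n list" where ys: "distinct ys" "set ys = UNIV"
    "map (\<lambda>i. sqrt (\<nu> i)) ys = singular_values M"
    using sorted_enumeration_by_key singular_values_eigenmatrix[OF Q] by metis
  then have len: "length ys = CARD('n)"
    by (metis distinct_card)
  \<comment> \<open>Index \<open>e k\<close> receives the eigenvector of the \<open>k\<close>-th
    largest singular value; list positions start at 0, hence the \<open>- 1\<close>.\<close>
  define r where "r a = ys ! (inv_into {1..CARD('n)} e a - 1)" for a
  have re: "r (e k) = ys ! (k - 1)" if "k \<in> {1..CARD('n)}" for k
    using that e by (simp add: r_def bij_betw_def)
  have ex_e: "\<exists>k\<in>{1..CARD('n)}. a = e k" for a
    using e by (metis UNIV_I bij_betw_imp_surj_on image_iff)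
  have inj_r: "r a = r b \<Longrightarrow> a = b" for a b
  proof -
    assume eq: "r a = r b"
    obtain k l where k: "k \<in> {1..CARD('n)}" "a = e k" and l: "l \<in> {1..CARD('n)}" "b = e l"
      using ex_e by metis
    then have "ys ! (k - 1) = ys ! (l - 1)"
      using eq re by simp
    then have "k - 1 = l - 1"
      using ys(1) k(1) l(1) len by (subst (asm) nth_eq_iff_index_eq) auto
    then show "a = b" using k l by (metis atLeastAtMost_iff le_add_diff_inverse)
  qed
  define V where "V = (\<chi> i j. Q $ i $ r j)"
  have colV: "column j V = column (r j) Q" for j
    by (simp add: column_def V_def)
  have V: "orthogonal_matrix V"
    using Q(1) inj_r unfolding orthogonal_matrix_orthonormal_columns colV by metis
  define \<mu> where "\<mu> a = \<nu> (r a)" for a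
  have BV: "transpose M ** M ** V = V ** diag \<mu>"
  proof -
    have "(transpose M ** M ** V) $ i $ j = (transpose M ** M ** Q) $ i $ r j" for i j
      by (simp add: matrix_matrix_mult_def V_def)
    moreover have "(V ** diag \<mu>) $ i $ j = (Q ** diag \<nu>) $ i $ r j" for i j
      by (simp add: matrix_matrix_mult_def diag_def V_def \<mu>_def if_distrib[where f = "\<lambda>x. _ * x"]
          cong: if_cong)
    ultimately show ?thesis by (simp add: vec_eq_iff Q(2))
  qed
  define W where "W = M ** V"
  have "transpose W ** W = transpose V ** (transpose M ** M ** V)"
    by (simp add: W_def matrix_transpose_mul matrix_mul_assoc)
  also have "\<dots> = diag \<mu>"
    unfolding BV using V by (simp add: matrix_mul_assoc orthogonal_matrix)
  finally have WW: "transpose W ** W = diag \<mu>" .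
  have "det W \<noteq> 0"
    using M det_orthogonal_matrix[OF V] by (auto simp: W_def det_mul invertible_det_nz)
  have \<mu>_pos: "\<mu> a > 0" for a
  proof -
    have "\<mu> a = (transpose W ** W) $ a $ a"
      by (simp add: WW diag_def)
    also have "\<dots> = column a W \<bullet> column a W"
      by (simp add: matrix_matrix_mult_def transpose_def column_def inner_vec_def)
    finally have "\<mu> a = column a W \<bullet> column a W" .
    moreover have "column a W \<noteq> 0"
      using \<open>det W \<noteq> 0\<close> det_zero_column by blast
    ultimately show ?thesis by simp
  qed
  define \<sigma> where "\<sigma> a = sqrt (\<mu> a)" for a
  have \<sigma>_pos: "\<sigma> a > 0" for a
    using \<mu>_pos by (simp add: \<sigma>_def)
  define U where "U = W ** diag (\<lambda>a. inverse (\<sigma> a))"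
  have "transpose U ** U = diag (\<lambda>a. inverse (\<sigma> a)) ** (transpose W ** W) ** diag (\<lambda>a. inverse (\<sigma> a))"
    by (simp add: U_def matrix_transpose_mul matrix_mul_assoc transpose_diag)
  also have "\<dots> = diag (\<lambda>_. 1)"
    unfolding WW diag_mult_diag using \<mu>_pos
    by (intro arg_cong[where f = diag]) (auto simp: \<sigma>_def fun_eq_iff field_simps less_imp_le
        less_imp_neq[symmetric])
  finally have U: "orthogonal_matrix U"
    by (simp add: orthogonal_matrix diag_1)
  have "U ** diag \<sigma> = W ** (diag (\<lambda>a. inverse (\<sigma> a)) ** diag \<sigma>)"
    by (simp add: U_def matrix_mul_assoc)
  also have "\<dots> = W"
    using \<sigma>_pos by (simp add: diag_mult_diag diag_1 less_imp_neq[symmetric])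
  finally have "U ** diag \<sigma> ** transpose V = M ** (V ** transpose V)"
    by (simp add: W_def matrix_mul_assoc)
  then have MUV: "M = U ** diag \<sigma> ** transpose V"
    using V by (simp add: orthogonal_matrix_def)
  have sv: "\<sigma> (e k) = singular_value k M" if "k \<in> {1..CARD('n)}" for k
    using that len by (auto simp: singular_value_def \<sigma>_def \<mu>_def re simp flip: ys(3))
  have "sorted (rev (singular_values M))"
    by (simp add: singular_values_def)
  moreover have "length (singular_values M) = CARD('n)"
    using len by (simp flip: ys(3))
  ultimately have mono: "\<sigma> (e l) \<le> \<sigma> (e k)" if "1 \<le> k" "k \<le> l" "l \<le> CARD('n)" for k l
    using that sorted_rev_nth_mono[of "singular_values M" "k - 1" "l - 1"]
    by (simp add: sv singular_value_def)
  show ?thesis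
    by (rule that[OF U V MUV \<sigma>_pos sv mono])
qed

section \<open>Volumes and products of singular values\<close>

text \<open>Up to constant factors, this is the volume spanned by the columns in \<open>S\<close>: the values of \<open>h\<close>
  outside \<open>S\<close> and the order of the rows only repeat each minor a fixed number of times.\<close>

definition vol :: "'n set \<Rightarrow> real^'n^'n \<Rightarrow> real" where
  "vol S W = (\<Sum>h\<in>UNIV. \<bar>minor S h id W\<bar>)"

definition sv_prod :: "nat \<Rightarrow> real^'n^'n \<Rightarrow> real" where
  "sv_prod L M = (\<Prod>k = 1..L. singular_value k M)"

lemma vol_nonneg [simp]: "vol S W \<ge> 0"
  by (simp add: vol_def sum_nonneg)

lemma abs_minor_le_vol: "\<bar>minor S h id W\<bar> \<le> vol S W"
  unfolding vol_def by (rule member_le_sum) auto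

lemma abs_det_le_vol: "\<bar>det W\<bar> \<le> vol UNIV W"
  by (metis abs_minor_le_vol minor_UNIV_id)

lemma card_funs_ge_1: "real CARD('n::finite \<Rightarrow> 'n) \<ge> 1"
  by (simp add: Suc_le_eq)

lemma card_ge_1: "real CARD('n::finite) \<ge> 1"
  by (simp add: Suc_le_eq)

lemma vol_mult_left_le:
  fixes M W :: "real^'n^'n"
  assumes "\<And>i j. \<bar>M $ i $ j\<bar> \<le> m" "m \<ge> 1"
  shows "vol S (M ** W) \<le> real CARD('n \<Rightarrow> 'n) * m ^ CARD('n) * vol S W"
proof -
  have "vol S (M ** W) \<le> (\<Sum>h\<in>(UNIV :: ('n \<Rightarrow> 'n) set). m ^ CARD('n) * vol S W)"
    unfolding vol_def using assms by (intro sum_mono minor_mult_left_le)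
  then show ?thesis by simp
qed

lemma orthogonal_matrix_entry_le:
  fixes Q :: "real^'n^'n"
  assumes "orthogonal_matrix Q"
  shows "\<bar>Q $ i $ j\<bar> \<le> 1"
proof -
  have "\<bar>Q $ i $ j\<bar> = \<bar>column j Q $ i\<bar>"
    by (simp add: column_def)
  also have "\<dots> \<le> norm (column j Q)"
    by (rule component_le_norm_cart)
  also have "\<dots> = 1"
    using assms by (simp add: orthogonal_matrix_orthonormal_columns)
  finally show ?thesis .
qed

text \<open>\<open>vol\<close> sums absolute minors and is not the Euclidean volume, so orthogonal
  matrices preserve it only up to a factor. Their entries have modulus at most 1, which permits
  \<open>m = 1\<close>.\<close>

lemma vol_orthogonal_le:
  fixes Q W :: "real^'n^'n"
  assumes "orthogonal_matrix Q"
  shows "vol S (Q ** W) \<le> real CARD('n \<Rightarrow> 'n) * vol S W"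
  using vol_mult_left_le[of Q 1 S W] orthogonal_matrix_entry_le[OF assms] by simp

lemma orthogonal_matrix_transpose_iff: "orthogonal_matrix (transpose Q) \<longleftrightarrow> orthogonal_matrix Q"
  by (auto simp: orthogonal_matrix_def)

lemma column_mult: "column j (A ** B) = A *v column j B"
  by (simp add: column_def matrix_matrix_mult_def matrix_vector_mult_def)

lemma norm_orthogonal_mult:
  "orthogonal_matrix Q \<Longrightarrow> norm (Q *v x) = norm (x :: real^'n)"
  using orthogonal_transformation_matrix[of "\<lambda>x. Q *v x"] by (simp add: orthogonal_transformation)

lemma norm_vector_orthogonal_mult:
  "orthogonal_matrix Q \<Longrightarrow> norm (x v* Q) = norm (x :: real^'n)"
  using norm_orthogonal_mult[of "transpose Q" x] by (simp add: orthogonal_matrix_transpose_iff)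

lemma entry_le_norm_column: "\<bar>W $ i $ j\<bar> \<le> norm (column j W)"
  using component_le_norm_cart[of "column j W" i] by (simp add: column_def)

text \<open>Hadamard's inequality with a crude constant, by Laplace expansion along one column at a
  time. \<open>h\<close> is arbitrary in the induction since each expansion replaces a row.\<close>

lemma abs_minor_le_prod_columns:
  fixes W :: "real^'n^'n"
  shows "\<bar>minor S h g W\<bar> \<le> real CARD('n) ^ card S * (\<Prod>b\<in>S. norm (column (g b) W))"
proof -
  have "finite S" by simp
  then show ?thesis
  proof (induction S arbitrary: h)
    case empty
    then show ?case by simp
  next
    case (insert l S)
    let ?B = "real CARD('n) ^ card S * (\<Prod>b\<in>S. norm (column (g b) W))"
    have "\<bar>minor (insert l S) h g W\<bar> \<le>
        (\<Sum>a\<in>insert l S. \<bar>(if a = l then 1 else -1) * W $ h a $ g l * minor S (h(a := h l)) g W\<bar>)"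
      unfolding minor_insert_col[OF insert.hyps(2)] by (rule sum_abs)
    also have "\<dots> \<le> (\<Sum>a\<in>insert l S. norm (column (g l) W) * ?B)"
      unfolding abs_mult
      by (intro sum_mono mult_mono insert.IH) (auto simp: entry_le_norm_column)
    also have "\<dots> = real (card (insert l S)) * (norm (column (g l) W) * ?B)"
      by (simp only: sum_constant)
    also have "\<dots> \<le> real CARD('n) * (norm (column (g l) W) * ?B)"
      by (intro mult_right_mono)
         (auto intro!: card_mono prod_nonneg mult_nonneg_nonneg simp del: card_insert_disjoint)
    finally show ?case
      using insert.hyps by (simp add: mult_ac)
  qed
qed

text \<open>Base times height, with the length of the new column for the height: expansion along
  this column has at most \<open>CARD('n)\<close> terms, and the sum over \<open>h\<close> gives the
  other factor.\<close>

lemma vol_insert_le: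
  fixes W :: "real^'n^'n"
  assumes "l \<notin> S"
  shows "vol (insert l S) W \<le>
    real CARD('n \<Rightarrow> 'n) * real CARD('n) * norm (column l W) * vol S W"
proof -
  have "\<bar>minor (insert l S) h id W\<bar> \<le> real CARD('n) * (norm (column l W) * vol S W)" for h
  proof -
    have "\<bar>minor (insert l S) h id W\<bar> \<le>
        (\<Sum>a\<in>insert l S. \<bar>(if a = l then 1 else -1) * W $ h a $ id l * minor S (h(a := h l)) id W\<bar>)"
      unfolding minor_insert_col[OF assms] by (rule sum_abs)
    also have "\<dots> \<le> (\<Sum>a\<in>insert l S. norm (column l W) * vol S W)"
      unfolding abs_mult
      by (intro sum_mono mult_mono) (auto simp: entry_le_norm_column abs_minor_le_vol)
    also have "\<dots> = real (card (insert l S)) * (norm (column l W) * vol S W)"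
      by (simp only: sum_constant)
    also have "\<dots> \<le> real CARD('n) * (norm (column l W) * vol S W)"
      by (intro mult_right_mono) (auto intro!: card_mono simp del: card_insert_disjoint)
    finally show ?thesis .
  qed
  then have "vol (insert l S) W \<le>
      (\<Sum>h\<in>(UNIV :: ('n \<Rightarrow> 'n) set). real CARD('n) * (norm (column l W) * vol S W))"
    unfolding vol_def by (rule sum_mono)
  then show ?thesis by (simp add: mult_ac)
qed

lemma vol_union_le:
  fixes W :: "real^'n^'n"
  assumes "S \<inter> T = {}"
  shows "vol (T \<union> S) W \<le>
    (real CARD('n \<Rightarrow> 'n) * real CARD('n)) ^ card T * (\<Prod>b\<in>T. norm (column b W)) * vol S W"
proof -
  have "finite T" by simp
  then show ?thesis using assms
  proof (induction T)
    case empty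
    then show ?case by simp
  next
    case (insert l T)
    let ?c = "real CARD('n \<Rightarrow> 'n) * real CARD('n)"
    have "vol (insert l T \<union> S) W \<le> ?c * norm (column l W) * vol (T \<union> S) W"
      using vol_insert_le[of l "T \<union> S" W] insert by simp
    also have "\<dots> \<le> ?c * norm (column l W) *
        (?c ^ card T * (\<Prod>b\<in>T. norm (column b W)) * vol S W)"
      using insert by (intro mult_left_mono) auto
    finally show ?case
      using insert.hyps by (simp add: mult_ac)
  qed
qed

text \<open>Read backwards, a lower bound for \<open>vol S\<close>; this is how a lower bound for
  the determinant reaches the volumes.\<close>

lemma abs_det_le_vol_columns:
  fixes W :: "real^'n^'n"
  shows "\<bar>det W\<bar> \<le> (real CARD('n \<Rightarrow> 'n) * real CARD('n)) ^ card (- S) *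
     (\<Prod>b\<in>-S. norm (column b W)) * vol S W"
  using vol_union_le[of S "- S" W] abs_det_le_vol[of W] by simp

text \<open>The index type has no order. \<open>e\<close> lists the indices, so that the first
  \<open>L\<close> columns and the position of a singular value make sense.\<close>

locale column_order =
  fixes e :: "nat \<Rightarrow> 'n::finite"
  assumes bij_e: "bij_betw e {1..CARD('n)} UNIV"
begin

definition first :: "nat \<Rightarrow> 'n set" where
  "first L = e ` {1..L}"

lemma ex_e: "\<exists>k\<in>{1..CARD('n)}. a = e k"
proof -
  have "a \<in> e ` {1..CARD('n)}"
    using bij_betw_imp_surj_on[OF bij_e] by simp
  then show ?thesis by blast
qed

lemma e_eq_iff: "k \<in> {1..CARD('n)} \<Longrightarrow> l \<in> {1..CARD('n)} \<Longrightarrow> e k = e l \<longleftrightarrow> k = l"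
  using bij_betw_imp_inj_on[OF bij_e] by (simp add: inj_on_eq_iff)

lemma inj_on_e: "L \<le> CARD('n) \<Longrightarrow> inj_on e {1..L}"
  by (rule inj_on_subset[OF bij_betw_imp_inj_on[OF bij_e]]) simp

lemma card_first: "L \<le> CARD('n) \<Longrightarrow> card (first L) = L"
  unfolding first_def by (subst card_image[OF inj_on_e]) auto

lemma first_0 [simp]: "first 0 = {}"
  by (simp add: first_def)

lemma first_Suc: "first (Suc L) = insert (e (Suc L)) (first L)"
  by (simp add: first_def atLeastAtMostSuc_conv)

lemma e_in_first_iff: "k \<in> {1..CARD('n)} \<Longrightarrow> L \<le> CARD('n) \<Longrightarrow> e k \<in> first L \<longleftrightarrow> k \<le> L"
  by (auto simp: first_def e_eq_iff)

lemma prod_first: "L \<le> CARD('n) \<Longrightarrow> prod \<sigma> (first L) = (\<Prod>k = 1..L. \<sigma> (e k))"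
  unfolding first_def by (subst prod.reindex[OF inj_on_e]) auto

text \<open>Exchange argument: \<open>J - first L\<close> and \<open>first L - J\<close> have equal
  size, and \<open>\<sigma> (e L)\<close> bounds the entries of the former from above and those of
  the latter from below.\<close>

lemma prod_le_prod_first:
  fixes \<sigma> :: "'n \<Rightarrow> real"
  assumes pos: "\<And>a. \<sigma> a > 0"
    and mono: "\<And>k l. 1 \<le> k \<Longrightarrow> k \<le> l \<Longrightarrow> l \<le> CARD('n) \<Longrightarrow> \<sigma> (e l) \<le> \<sigma> (e k)"
    and J: "card J = L" "L \<le> CARD('n)"
  shows "prod \<sigma> J \<le> prod \<sigma> (first L)"
\<comment> \<open>For \<open>L = 0\<close> there is no threshold, as \<open>e 0\<close> is outside
  the enumeration.\<close>
proof (cases "L = 0")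
  case True
  with J show ?thesis by simp
next
  case False
  let ?I = "first L"
  have card: "card (J - ?I) = card (?I - J)"
    using J(1) card_first[OF J(2)] by (simp add: card_Diff_subset_Int Int_commute)
  have "prod \<sigma> (J - ?I) \<le> (\<Prod>a\<in>J - ?I. \<sigma> (e L))"
  proof (rule prod_mono)
    fix a assume a: "a \<in> J - ?I"
    obtain k where k: "k \<in> {1..CARD('n)}" "a = e k"
      using ex_e by blast
    then have "L < k"
      using a J(2) by (auto simp: e_in_first_iff)
    then show "0 \<le> \<sigma> a \<and> \<sigma> a \<le> \<sigma> (e L)"
      using k mono[of L k] pos[of a] False by auto
  qed
  also have "\<dots> = (\<Prod>a\<in>?I - J. \<sigma> (e L))"
    by (simp add: card)
  also have "\<dots> \<le> prod \<sigma> (?I - J)"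
  proof (rule prod_mono)
    fix a assume a: "a \<in> ?I - J"
    then obtain k where k: "k \<in> {1..L}" "a = e k"
      by (auto simp: first_def)
    then show "0 \<le> \<sigma> (e L) \<and> \<sigma> (e L) \<le> \<sigma> a"
      using mono[of k L] pos[of "e L"] J(2) by auto
  qed
  finally have le: "prod \<sigma> (J - ?I) \<le> prod \<sigma> (?I - J)" .
  have "prod \<sigma> J = prod \<sigma> (J \<inter> ?I) * prod \<sigma> (J - ?I)"
    by (rule prod.Int_Diff) simp
  also have "\<dots> \<le> prod \<sigma> (J \<inter> ?I) * prod \<sigma> (?I - J)"
    using le pos by (intro mult_left_mono prod_nonneg) (auto simp: less_imp_le)
  also have "\<dots> = prod \<sigma> ?I"
    using prod.Int_Diff[of ?I \<sigma> J] by (simp add: Int_commute)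
  finally show ?thesis .
qed

text \<open>The exchange argument made strict: for \<open>J \<noteq> first L\<close> the exchanged
  part is nonempty. A simple spectrum thus makes \<open>first L\<close> the unique choice of
  \<open>L\<close> columns with maximal sum of exponents.\<close>

lemma sum_less_sum_first:
  fixes \<mu> :: "'n \<Rightarrow> real"
  assumes mono: "\<And>k l. 1 \<le> k \<Longrightarrow> k < l \<Longrightarrow> l \<le> CARD('n) \<Longrightarrow> \<mu> (e l) < \<mu> (e k)"
    and J: "card J = L" "L \<le> CARD('n)" "J \<noteq> first L"
  shows "sum \<mu> J < sum \<mu> (first L)"
proof -
  let ?I = "first L"
  have "L \<noteq> 0" using J by auto
  have card: "card (J - ?I) = card (?I - J)"
    using J(1) card_first[OF J(2)] by (simp add: card_Diff_subset_Int Int_commute)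
  have ne: "J - ?I \<noteq> {}"
    using J card_first[OF J(2)] card_subset_eq[of ?I J] by auto
  have "sum \<mu> (J - ?I) < (\<Sum>a\<in>J - ?I. \<mu> (e L))"
  proof (rule sum_strict_mono)
    fix a assume a: "a \<in> J - ?I"
    obtain k where k: "k \<in> {1..CARD('n)}" "a = e k"
      using ex_e by blast
    then have "L < k"
      using a J(2) by (auto simp: e_in_first_iff)
    then show "\<mu> a < \<mu> (e L)"
      using k mono[of L k] \<open>L \<noteq> 0\<close> by auto
  qed (use ne in auto)
  also have "\<dots> = (\<Sum>a\<in>?I - J. \<mu> (e L))"
    by (simp add: card)
  also have "\<dots> \<le> sum \<mu> (?I - J)"
  proof (rule sum_mono)
    fix a assume a: "a \<in> ?I - J"
    then obtain k where k: "k \<in> {1..L}" "a = e k"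
      by (auto simp: first_def)
    then show "\<mu> (e L) \<le> \<mu> a"
      using mono[of k L] J(2) by (cases "k = L") auto
  qed
  finally have le: "sum \<mu> (J - ?I) < sum \<mu> (?I - J)" .
  have "sum \<mu> J = sum \<mu> (J \<inter> ?I) + sum \<mu> (J - ?I)"
    by (rule sum.Int_Diff) simp
  also have "\<dots> < sum \<mu> (J \<inter> ?I) + sum \<mu> (?I - J)"
    using le by simp
  also have "\<dots> = sum \<mu> ?I"
    using sum.Int_Diff[of ?I \<mu> J] by (simp add: Int_commute)
  finally show ?thesis .
qed

lemma singular_value_factorization:
  fixes M :: "real^'n^'n"
  assumes "invertible M"
  obtains U V \<sigma> where "orthogonal_matrix U" "orthogonal_matrix V"
    "M = U ** diag \<sigma> ** transpose V" "\<And>a. \<sigma> a > 0"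
    "\<And>L. L \<le> CARD('n) \<Longrightarrow> prod \<sigma> (first L) = sv_prod L M"
    "\<And>J L. card J = L \<Longrightarrow> L \<le> CARD('n) \<Longrightarrow> prod \<sigma> J \<le> sv_prod L M"
proof -
  obtain U V \<sigma> where *: "orthogonal_matrix U" "orthogonal_matrix V"
    "M = U ** diag \<sigma> ** transpose V" "\<And>a. \<sigma> a > 0"
    "\<And>k. k \<in> {1..CARD('n)} \<Longrightarrow> \<sigma> (e k) = singular_value k M"
    "\<And>k l. 1 \<le> k \<Longrightarrow> k \<le> l \<Longrightarrow> l \<le> CARD('n) \<Longrightarrow> \<sigma> (e l) \<le> \<sigma> (e k)"
    by (rule singular_value_decomposition[OF assms bij_e]) (rule that)
  have eq: "prod \<sigma> (first L) = sv_prod L M" if "L \<le> CARD('n)" for L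
    using that by (simp add: prod_first sv_prod_def *(5))
  have le: "prod \<sigma> J \<le> sv_prod L M" if "card J = L" "L \<le> CARD('n)" for J L
    using prod_le_prod_first[of \<sigma> J L] *(4,6) that eq[of L] by metis
  show ?thesis
    by (rule that[OF *(1-4) eq le])
qed

lemma sv_prod_pos:
  fixes M :: "real^'n^'n"
  assumes "invertible M" "L \<le> CARD('n)"
  shows "sv_prod L M > 0"
proof -
  obtain U V \<sigma> where UV: "orthogonal_matrix U" "orthogonal_matrix V"
    "M = U ** diag \<sigma> ** transpose V" "\<And>a. \<sigma> a > 0"
    "\<And>L. L \<le> CARD('n) \<Longrightarrow> prod \<sigma> (first L) = sv_prod L M"
    "\<And>J L. card J = L \<Longrightarrow> L \<le> CARD('n) \<Longrightarrow> prod \<sigma> J \<le> sv_prod L M"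
    by (rule singular_value_factorization[OF assms(1)]) (rule that)
  show ?thesis
    using UV(5)[OF assms(2)] prod_pos[of "first L" \<sigma>] UV(4) by simp
qed

lemma singular_value_antimono:
  fixes M :: "real^'n^'n"
  assumes "invertible M" "1 \<le> k" "k \<le> l" "l \<le> CARD('n)"
  shows "singular_value l M \<le> singular_value k M"
proof -
  obtain U V \<sigma> where *: "orthogonal_matrix U" "orthogonal_matrix V"
    "M = U ** diag \<sigma> ** transpose V" "\<And>a. \<sigma> a > 0"
    "\<And>k. k \<in> {1..CARD('n)} \<Longrightarrow> \<sigma> (e k) = singular_value k M"
    "\<And>k l. 1 \<le> k \<Longrightarrow> k \<le> l \<Longrightarrow> l \<le> CARD('n) \<Longrightarrow> \<sigma> (e l) \<le> \<sigma> (e k)"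
    by (rule singular_value_decomposition[OF assms(1) bij_e]) (rule that)
  then show ?thesis
    using *(6)[OF assms(2-4)] *(5)[of k] *(5)[of l] assms(2-4) by simp
qed

text \<open>The diagonal factor of the decomposition multiplies a minor by \<open>L\<close> singular
  values at distinct indices, whose product is at most \<open>sv_prod L M\<close>; row choices
  repeating an index have zero minor. Each orthogonal factor costs one
  \<open>CARD('n \<Rightarrow> 'n)\<close>.\<close>

lemma vol_mult_le_sv_prod:
  fixes M W :: "real^'n^'n"
  assumes "invertible M" "L \<le> CARD('n)"
  shows "vol (first L) (M ** W) \<le> real CARD('n \<Rightarrow> 'n) ^ 2 * sv_prod L M * vol (first L) W"
proof -
  let ?K = "real CARD('n \<Rightarrow> 'n)"
  obtain U V \<sigma> where UV: "orthogonal_matrix U" "orthogonal_matrix V"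
    "M = U ** diag \<sigma> ** transpose V" "\<And>a. \<sigma> a > 0"
    "\<And>L. L \<le> CARD('n) \<Longrightarrow> prod \<sigma> (first L) = sv_prod L M"
    "\<And>J L. card J = L \<Longrightarrow> L \<le> CARD('n) \<Longrightarrow> prod \<sigma> J \<le> sv_prod L M"
    by (rule singular_value_factorization[OF assms(1)]) (rule that)
  have diag: "vol (first L) (diag \<sigma> ** Z) \<le> sv_prod L M * vol (first L) Z" for Z
  proof -
    have "\<bar>minor (first L) h id (diag \<sigma> ** Z)\<bar> \<le> sv_prod L M * \<bar>minor (first L) h id Z\<bar>" for h
    proof (cases "inj_on h (first L)")
      case True
      have "(\<Prod>a\<in>first L. \<sigma> (h a)) = prod \<sigma> (h ` first L)"
        using True by (simp add: prod.reindex)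
      also have "\<dots> \<le> sv_prod L M"
        using True assms(2) by (intro UV(6)) (auto simp: card_image card_first)
      finally have "(\<Prod>a\<in>first L. \<sigma> (h a)) \<le> sv_prod L M" .
      moreover have "(\<Prod>a\<in>first L. \<sigma> (h a)) \<ge> 0"
        using UV(4) by (intro prod_nonneg) (auto simp: less_imp_le)
      ultimately show ?thesis
        by (simp add: minor_diag_mult abs_mult mult_right_mono)
    qed (simp add: minor_not_inj_rows)
    then show ?thesis
      by (simp add: vol_def sum_distrib_left sum_mono)
  qed
  have "vol (first L) (M ** W) = vol (first L) (U ** (diag \<sigma> ** (transpose V ** W)))"
    by (simp add: UV(3) matrix_mul_assoc)
  also have "\<dots> \<le> ?K * vol (first L) (diag \<sigma> ** (transpose V ** W))"
    by (rule vol_orthogonal_le[OF UV(1)])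
  also have "\<dots> \<le> ?K * (sv_prod L M * vol (first L) (transpose V ** W))"
    by (intro mult_left_mono diag) simp
  also have "\<dots> \<le> ?K * (sv_prod L M * (?K * vol (first L) W))"
    using UV(2) sv_prod_pos[OF assms]
    by (intro mult_left_mono vol_orthogonal_le)
       (auto simp: orthogonal_matrix_transpose_iff)
  finally show ?thesis
    by (simp add: power2_eq_square mult_ac)
qed

text \<open>Solve the decomposition for the diagonal factor, whose minor on \<open>first L\<close>
  is exactly \<open>sv_prod L M\<close>. Expanding rows and then columns leaves minors of
  \<open>M\<close> with coefficients of modulus at most 1.\<close>

lemma sv_prod_le_minors:
  fixes M :: "real^'n^'n"
  assumes "invertible M" "L \<le> CARD('n)"
  shows "sv_prod L M \<le> (\<Sum>h\<in>UNIV. \<Sum>g\<in>UNIV. \<bar>minor (first L) h g M\<bar>)"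
proof -
  let ?S = "first L"
  obtain U V \<sigma> where UV: "orthogonal_matrix U" "orthogonal_matrix V"
    "M = U ** diag \<sigma> ** transpose V" "\<And>a. \<sigma> a > 0"
    "\<And>L. L \<le> CARD('n) \<Longrightarrow> prod \<sigma> (first L) = sv_prod L M"
    "\<And>J L. card J = L \<Longrightarrow> L \<le> CARD('n) \<Longrightarrow> prod \<sigma> J \<le> sv_prod L M"
    by (rule singular_value_factorization[OF assms(1)]) (rule that)
  have "transpose U ** (M ** V) = (transpose U ** U) ** diag \<sigma> ** (transpose V ** V)"
    by (simp add: UV(3) matrix_mul_assoc)
  then have D: "diag \<sigma> = transpose U ** (M ** V)"
    using UV(1,2) by (simp add: orthogonal_matrix)
  have "sv_prod L M = minor ?S id id (diag \<sigma>)"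
    using minor_diag_mult[of ?S id id \<sigma> "mat 1"] UV(5)[OF assms(2)] by simp
  also have "\<dots> \<le> \<bar>minor ?S id id (transpose U ** (M ** V))\<bar>"
    by (simp add: D)
  also have "\<dots> \<le> (\<Sum>h\<in>UNIV. \<bar>minor ?S h id (M ** V)\<bar>)"
    using minor_mult_left_le[of "transpose U" 1 ?S id id "M ** V"] UV(1)
    by (simp add: orthogonal_matrix_entry_le orthogonal_matrix_transpose_iff)
  also have "\<dots> \<le> (\<Sum>h\<in>UNIV. \<Sum>g\<in>UNIV. \<bar>minor ?S h g M\<bar>)"
  proof (rule sum_mono)
    fix h :: "'n \<Rightarrow> 'n"
    show "\<bar>minor ?S h id (M ** V)\<bar> \<le> (\<Sum>g\<in>UNIV. \<bar>minor ?S h g M\<bar>)"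
      using minor_mult_left_le[of "transpose V" 1 ?S id h "transpose M"] UV(2)
      by (simp add: orthogonal_matrix_entry_le orthogonal_matrix_transpose_iff
          minor_transpose flip: matrix_transpose_mul)
  qed
  finally show ?thesis .
qed

text \<open>For \<open>M = U diag \<sigma> V\<^sup>T\<close>, put \<open>W = V\<^sup>T Z\<close>. The hypothesis yields a set of rows of
  \<open>W\<close>, given by \<open>h\<close>, on which the minor of the first \<open>m + 1\<close> columns is large and all singular
  values are large. If \<open>M\<close> makes column \<open>e (m + 2)\<close> short, then its entries in these rows are small,
  so one of its other entries is large, and the corresponding minor of size \<open>m + 2\<close> is large.\<close>

lemma column_le_vol_quotient:
  fixes M Z :: "real^'n^'n"
  assumes M: "invertible M" and m: "Suc (Suc m) \<le> CARD('n)"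
    and pos: "vol (first (Suc m)) Z > 0" and q: "q \<ge> 0"
    and growth: "sv_prod (Suc m) M * vol (first (Suc m)) Z \<le> q * vol (first (Suc m)) (M ** Z)"
  defines "l \<equiv> e (Suc (Suc m))"
  shows "norm (column l Z) * vol (first (Suc m)) Z \<le>
    real CARD('n) ^ 2 * real CARD('n \<Rightarrow> 'n) ^ 6 * q *
      (vol (first (Suc (Suc m))) Z +
       q * (norm (column l (M ** Z)) * sv_prod m M / sv_prod (Suc m) M) * vol (first (Suc m)) Z)"
proof -
  define K where "K = real CARD('n \<Rightarrow> 'n)"
  define N where "N = real CARD('n)"
  have K: "K \<ge> 1" and N: "N \<ge> 1"
    by (simp_all only: K_def N_def card_funs_ge_1 card_ge_1)
  let ?S = "first (Suc m)"
  let ?v = "vol ?S Z"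
  let ?P = "sv_prod (Suc m) M"
  let ?P' = "sv_prod m M"
  let ?n = "norm (column l (M ** Z))"
  have lS: "l \<notin> ?S"
    using m e_in_first_iff[of "Suc (Suc m)" "Suc m"] by (simp add: l_def)
  obtain U V \<sigma> where UV: "orthogonal_matrix U" "orthogonal_matrix V"
    "M = U ** diag \<sigma> ** transpose V" "\<And>a. \<sigma> a > 0"
    "\<And>L. L \<le> CARD('n) \<Longrightarrow> prod \<sigma> (first L) = sv_prod L M"
    "\<And>J L. card J = L \<Longrightarrow> L \<le> CARD('n) \<Longrightarrow> prod \<sigma> J \<le> sv_prod L M"
    by (rule singular_value_factorization[OF M]) (rule that)
  have P: "?P > 0" "?P' > 0"
    using sv_prod_pos[OF M] m by simp_all
  define W where "W = transpose V ** Z"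
  have MZ: "M ** Z = U ** (diag \<sigma> ** W)"
    by (simp add: UV(3) W_def matrix_mul_assoc)
  have volW: "vol S W \<le> K * vol S Z" for S
    unfolding W_def K_def using UV(2)
    by (intro vol_orthogonal_le) (simp add: orthogonal_matrix_transpose_iff)
  define p where "p h = (\<Prod>a\<in>?S. \<sigma> (h a))" for h
  have p_pos: "p h > 0" for h
    unfolding p_def using UV(4) by (intro prod_pos) simp
  define \<mu> where "\<mu> h = \<bar>minor ?S h id W\<bar>" for h
  \<comment> \<open>Pigeonhole: one of the \<open>CARD('n \<Rightarrow> 'n)\<close> row choices
    carries at least the average share of \<open>vol\<close>.\<close>
  have "\<exists>h. vol ?S (diag \<sigma> ** W) \<le> K * (p h * \<mu> h)"
  proof (rule ccontr)
    assume "\<not> ?thesis"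
    then have "p h * \<mu> h < vol ?S (diag \<sigma> ** W) / K" for h
      using K by (auto simp: not_le field_simps)
    then have "(\<Sum>h\<in>UNIV. p h * \<mu> h) < (\<Sum>h\<in>(UNIV::('n \<Rightarrow> 'n) set). vol ?S (diag \<sigma> ** W) / K)"
      by (intro sum_strict_mono) auto
    also have "\<dots> = vol ?S (diag \<sigma> ** W)"
      using K by (simp only: sum_constant flip: K_def) simp
    also have "\<dots> = (\<Sum>h\<in>UNIV. p h * \<mu> h)"
      unfolding vol_def using p_pos
      by (simp add: minor_diag_mult abs_mult \<mu>_def less_imp_le flip: p_def)
    finally show False by simp
  qed
  then obtain h where h: "vol ?S (diag \<sigma> ** W) \<le> K * (p h * \<mu> h)" by blast
  have "?P * ?v \<le> q * (K * vol ?S (diag \<sigma> ** W))"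
    using growth q vol_orthogonal_le[OF UV(1), of ?S "diag \<sigma> ** W"]
    unfolding MZ K_def by (meson mult_left_mono order_trans)
  also have "\<dots> \<le> q * (K * (K * (p h * \<mu> h)))"
    using q K h by (intro mult_left_mono) auto
  finally have Pv: "?P * ?v \<le> q * K\<^sup>2 * p h * \<mu> h"
    by (simp add: power2_eq_square mult_ac)
  have "\<mu> h \<noteq> 0"
    using Pv mult_pos_pos[OF P(1) pos] by auto
  then have inj: "inj_on h ?S"
    using minor_not_inj_rows[of h ?S id W] by (auto simp: \<mu>_def)
  have "p h = prod \<sigma> (h ` ?S)"
    using inj by (simp add: p_def prod.reindex)
  also have "\<dots> \<le> ?P"
    using inj m by (intro UV(6)) (auto simp: card_image card_first)
  finally have "p h \<le> ?P" .
  \<comment> \<open>\<open>Pv\<close> is used twice: bounding \<open>p h\<close> by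
    \<open>?P\<close> shows that the minor \<open>\<mu> h\<close> is large, and bounding
    \<open>\<mu> h\<close> by \<open>K * ?v\<close> shows that \<open>p h\<close> is nearly
    maximal.\<close>
  have "?P * ?v \<le> q * K\<^sup>2 * ?P * \<mu> h"
    using Pv \<open>p h \<le> ?P\<close> q
    by (elim order_trans) (intro mult_right_mono mult_left_mono, auto simp: \<mu>_def)
  then have v: "?v \<le> q * K\<^sup>2 * \<mu> h"
    using P by (simp add: mult.left_commute mult.assoc)
  have "\<mu> h \<le> K * ?v"
    using abs_minor_le_vol[of ?S h W] volW[of ?S] by (simp add: \<mu>_def)
  then have "?P * ?v \<le> q * K\<^sup>2 * p h * (K * ?v)"
    using Pv q p_pos[of h] by (elim order_trans) (intro mult_left_mono, auto)
  then have Pp: "?P \<le> q * K ^ 3 * p h"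
    using pos by (simp add: power2_eq_square power3_eq_cube mult_ac)
  \<comment> \<open>\<open>p h\<close> is \<open>\<sigma> (h a)\<close> times \<open>m\<close> other
    singular values of product at most \<open>?P'\<close>, so \<open>\<sigma> (h a)\<close> is at
    least about \<open>?P / ?P'\<close>. Since
    \<open>\<sigma> (h a) * \<bar>W $ h a $ l\<bar>\<close> is at most \<open>?n\<close>, the entry
    is at most \<open>\<delta>\<close>.\<close>
  define \<delta> where "\<delta> = q * K ^ 3 * (?n * ?P' / ?P)"
  have \<delta>: "\<delta> \<ge> 0"
    using q K P by (simp add: \<delta>_def)
  have small: "\<bar>W $ h a $ l\<bar> \<le> \<delta>" if a: "a \<in> ?S" for a
  proof -
    have "p h = \<sigma> (h a) * (\<Prod>a\<in>?S - {a}. \<sigma> (h a))"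
      unfolding p_def using a by (intro prod.remove) auto
    also have "(\<Prod>a\<in>?S - {a}. \<sigma> (h a)) = prod \<sigma> (h ` (?S - {a}))"
      using inj_on_subset[OF inj, of "?S - {a}"] by (simp add: prod.reindex)
    also have "\<dots> \<le> ?P'"
    proof (rule UV(6))
      show "card (h ` (?S - {a})) = m"
        using inj_on_subset[OF inj, of "?S - {a}"] a m by (simp add: card_image card_first)
    qed (use m in simp)
    finally have ph: "p h \<le> \<sigma> (h a) * ?P'"
      using UV(4) by (simp add: less_imp_le)
    have "(transpose U ** (M ** Z)) = diag \<sigma> ** W"
      using UV(1) by (simp add: MZ matrix_mul_assoc orthogonal_matrix)
    moreover have "(diag \<sigma> ** W) $ h a $ l = \<sigma> (h a) * W $ h a $ l"
      by (simp add: matrix_matrix_mult_def diag_def if_distrib[where f = "\<lambda>x. x * _"] cong: if_cong)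
    ultimately have "\<sigma> (h a) * \<bar>W $ h a $ l\<bar> = \<bar>(transpose U ** (M ** Z)) $ h a $ l\<bar>"
      using UV(4)[of "h a"] by (simp add: abs_mult)
    also have "\<dots> \<le> norm (column l (transpose U ** (M ** Z)))"
      by (rule entry_le_norm_column)
    also have "\<dots> = ?n"
      using UV(1) by (simp add: column_mult norm_vector_orthogonal_mult)
    finally have \<sigma>W: "\<sigma> (h a) * \<bar>W $ h a $ l\<bar> \<le> ?n" .
    have "?P * \<bar>W $ h a $ l\<bar> \<le> q * K ^ 3 * (\<sigma> (h a) * ?P') * \<bar>W $ h a $ l\<bar>"
      using Pp ph q K by (intro mult_right_mono, elim order_trans) (intro mult_left_mono, auto)
    also have "\<dots> = q * K ^ 3 * ?P' * (\<sigma> (h a) * \<bar>W $ h a $ l\<bar>)"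
      by simp
    also have "\<dots> \<le> q * K ^ 3 * ?P' * ?n"
      using \<sigma>W q K P by (intro mult_left_mono) auto
    finally show ?thesis
      using P by (simp add: \<delta>_def field_simps)
  qed
  have "\<exists>k. norm (column l Z) \<le> N * \<bar>W $ k $ l\<bar>"
  proof (rule ccontr)
    assume "\<not> ?thesis"
    then have "\<bar>W $ k $ l\<bar> < norm (column l Z) / N" for k
      using N by (auto simp: not_le field_simps)
    then have "(\<Sum>k\<in>UNIV. \<bar>W $ k $ l\<bar>) < (\<Sum>k\<in>(UNIV::'n set). norm (column l Z) / N)"
      by (intro sum_strict_mono) auto
    also have "\<dots> = norm (column l Z)"
      using N by (simp only: sum_constant flip: N_def) simp
    also have "\<dots> = norm (column l W)"
      using UV(2) by (simp add: W_def column_mult norm_vector_orthogonal_mult)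
    also have "\<dots> \<le> (\<Sum>k\<in>UNIV. \<bar>W $ k $ l\<bar>)"
      using norm_le_l1_cart[of "column l W"] by (simp add: column_def)
    finally show False by simp
  qed
  then obtain k where k: "norm (column l Z) \<le> N * \<bar>W $ k $ l\<bar>" by blast
  \<comment> \<open>Row \<open>k\<close> joins the selection. In the expansion along column
    \<open>l\<close>, the term of row \<open>k\<close> is \<open>W $ k $ l\<close> times the large
    minor; every other term contains an entry bounded by \<open>\<delta>\<close>.\<close>
  let ?h = "h(l := k)"
  have "minor (insert l ?S) ?h id W = W $ k $ l * minor ?S ?h id W -
      (\<Sum>a\<in>?S. W $ h a $ l * minor ?S (?h(a := k)) id W)"
    unfolding minor_insert_col[OF lS]
    using lS by (subst sum.insert) (auto simp: sum_negf[symmetric] intro!: sum.cong)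
  moreover have "minor ?S ?h id W = minor ?S h id W"
    using lS by (intro minor_cong) auto
  ultimately have "\<bar>W $ k $ l\<bar> * \<mu> h \<le> \<bar>minor (insert l ?S) ?h id W\<bar> +
      \<bar>\<Sum>a\<in>?S. W $ h a $ l * minor ?S (?h(a := k)) id W\<bar>"
    by (simp add: \<mu>_def flip: abs_mult)
  also have "\<bar>\<Sum>a\<in>?S. W $ h a $ l * minor ?S (?h(a := k)) id W\<bar> \<le> (\<Sum>a\<in>?S. \<delta> * vol ?S W)"
    using small
    by (intro order_trans[OF sum_abs] sum_mono)
       (auto simp: abs_mult intro!: mult_mono abs_minor_le_vol intro: order_trans[OF abs_ge_zero])
  also have "\<dots> \<le> N * (\<delta> * vol ?S W)"
    using \<delta> unfolding sum_constant N_def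
    by (intro mult_right_mono mult_nonneg_nonneg) (auto intro!: card_mono)
  also have "\<dots> \<le> N * (\<delta> * (K * ?v))"
    using q K P N volW[of ?S] unfolding \<delta>_def by (intro mult_left_mono) auto
  also have "\<bar>minor (insert l ?S) ?h id W\<bar> \<le> K * vol (insert l ?S) Z"
    using abs_minor_le_vol volW by (rule order_trans)
  finally have Wkl: "\<bar>W $ k $ l\<bar> * \<mu> h \<le> K * vol (insert l ?S) Z + N * (\<delta> * (K * ?v))"
    by simp
  have "norm (column l Z) * ?v \<le> (N * \<bar>W $ k $ l\<bar>) * (q * K\<^sup>2 * \<mu> h)"
    using k v pos N by (intro mult_mono) auto
  also have "\<dots> = N * q * K\<^sup>2 * (\<bar>W $ k $ l\<bar> * \<mu> h)"
    by simp
  also have "\<dots> \<le> N * q * K\<^sup>2 * (K * vol (insert l ?S) Z + N * (\<delta> * (K * ?v)))"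
    using Wkl N q by (intro mult_left_mono) auto
  \<comment> \<open>\<open>K ^ 6\<close> collects \<open>K\<^sup>2\<close> from \<open>v\<close>,
    \<open>K ^ 3\<close> from \<open>\<delta>\<close> and \<open>K\<close> from \<open>volW\<close>;
    one \<open>N\<close> stems from the choice of \<open>k\<close>, the other from the number of
    terms.\<close>
  also have "\<dots> = N * K ^ 3 * q * vol (insert l ?S) Z + N\<^sup>2 * K ^ 6 * q * (q * (?n * ?P' / ?P) * ?v)"
    unfolding \<delta>_def by (simp add: algebra_simps power2_eq_square eval_nat_numeral)
  also have "\<dots> \<le> N\<^sup>2 * K ^ 6 * q * vol (insert l ?S) Z + N\<^sup>2 * K ^ 6 * q * (q * (?n * ?P' / ?P) * ?v)"
  proof -
    have "N * K ^ 3 \<le> N\<^sup>2 * K ^ 6"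
      using N K power_increasing[of 1 2 N] power_increasing[of 3 6 K] by (intro mult_mono) auto
    then show ?thesis
      using q by (intro add_right_mono mult_right_mono) auto
  qed
  finally show ?thesis
    by (simp add: first_Suc[of "Suc m"] l_def K_def N_def algebra_simps)
qed

end

section \<open>Linear systems and their exponents\<close>

text \<open>Reduces dimensions of spaces of solutions to dimensions of sets of coefficient
  vectors.\<close>

lemma dim_fun_image:
  fixes \<Phi> :: "real^'n \<Rightarrow> real \<Rightarrow> real^'n"
  assumes add: "\<And>x y. \<Phi> (x + y) = \<Phi> x + \<Phi> y"
    and scale: "\<And>c x. \<Phi> (c *\<^sub>R x) = (\<lambda>t. c *\<^sub>R \<Phi> x t)"
    and inj: "inj \<Phi>"
  shows "fun_vs.dim (\<Phi> ` S) = dim S"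
proof -
  let ?sc = "\<lambda>(c::real) (f :: real \<Rightarrow> real^'n) t. c *\<^sub>R f t"
  interpret pair: finite_dimensional_vector_space_pair_1
    "scaleR :: real \<Rightarrow> real^'n \<Rightarrow> real^'n" Basis ?sc
    by unfold_locales
  have "Vector_Spaces.linear scaleR ?sc \<Phi>"
    by unfold_locales (simp_all add: add scale)
  then show ?thesis
    using pair.dim_image_eq[of \<Phi> S] inj_on_subset[OF inj subset_UNIV]
    unfolding dim_raw_def span_raw_def by blast
qed

lemma norm_matrix_vector_le: "norm (A *v x) \<le> real CARD('n) * norm A * norm x"
  for A :: "real^'n^'n" and x :: "real^'n"
proof -
  have "\<bar>(A *v x) $ i\<bar> \<le> norm A * norm x" for i
  proof -
    have "\<bar>(A *v x) $ i\<bar> = \<bar>A $ i \<bullet> x\<bar>"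
      by (simp add: matrix_vector_mul_component)
    also have "\<dots> \<le> norm (A $ i) * norm x"
      by (rule Cauchy_Schwarz_ineq2)
    also have "\<dots> \<le> norm A * norm x"
      by (intro mult_right_mono Finite_Cartesian_Product.norm_nth_le) auto
    finally show ?thesis .
  qed
  then have "(\<Sum>i\<in>UNIV. \<bar>(A *v x) $ i\<bar>) \<le> (\<Sum>i\<in>(UNIV::'n set). norm A * norm x)"
    by (intro sum_mono) auto
  with norm_le_l1_cart[of "A *v x"] show ?thesis by simp
qed

text \<open>Gronwall by monotonicity: \<open>x t \<bullet> x t\<close> times
  \<open>exp (- 2 * K * t)\<close> decreases, and times \<open>exp (2 * K * t)\<close> it increases.
  Only interior times are differentiated, where the derivative within \<open>{0..}\<close> is
  two-sided.\<close>

lemma solution_norm_bounds: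
  fixes x :: "real \<Rightarrow> real^'n"
  assumes x: "\<And>t. t \<ge> 0 \<Longrightarrow> (x has_vector_derivative A t *v x t) (at t within {0..})"
    and A: "\<And>t y. t \<ge> 0 \<Longrightarrow> norm (A t *v y) \<le> K * norm y"
    and t: "0 \<le> t"
  shows "norm (x t) \<le> exp (K * t) * norm (x 0)" "norm (x 0) \<le> exp (K * t) * norm (x t)"
proof -
  have deriv: "((\<lambda>t. (x t \<bullet> x t) * exp (c * t)) has_real_derivative
      (2 * (x s \<bullet> (A s *v x s)) + c * (x s \<bullet> x s)) * exp (c * s)) (at s)" if "s > 0" for s c
  proof -
    have "(x has_vector_derivative A s *v x s) (at s)"
      using x[of s] that at_within_interior[of s "{0..}"] by simp
    then have "(x has_derivative (\<lambda>h. h *\<^sub>R (A s *v x s))) (at s)"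
      by (simp add: has_vector_derivative_def)
    from has_derivative_inner[OF this this]
    have "((\<lambda>t. x t \<bullet> x t) has_real_derivative 2 * (x s \<bullet> (A s *v x s))) (at s)"
      unfolding has_field_derivative_def
      by (rule has_derivative_eq_rhs) (auto simp: inner_commute)
    from this show ?thesis
      by (auto intro!: derivative_eq_intros simp: algebra_simps)
  qed
  have cont: "continuous_on {0..t} (\<lambda>t. (x t \<bullet> x t) * exp (c * t))" for c
  proof -
    have "continuous_on {0..} x"
      using x by (auto simp: continuous_on_eq_continuous_within intro: has_vector_derivative_continuous)
    then show ?thesis
      by (intro continuous_intros) (auto intro: continuous_on_subset)
  qed
  have bound: "\<bar>x s \<bullet> (A s *v x s)\<bar> \<le> K * (x s \<bullet> x s)" if "s > 0" for s
  proof -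
    have "\<bar>x s \<bullet> (A s *v x s)\<bar> \<le> norm (x s) * norm (A s *v x s)"
      by (rule Cauchy_Schwarz_ineq2)
    also have "\<dots> \<le> norm (x s) * (K * norm (x s))"
      using A that by (intro mult_left_mono) auto
    finally show ?thesis by (simp add: dot_square_norm power2_eq_square mult_ac)
  qed
  have "(x t \<bullet> x t) * exp ((- 2 * K) * t) \<le> (x 0 \<bullet> x 0) * exp ((- 2 * K) * 0)"
    using t
  proof (rule DERIV_nonpos_imp_decreasing_open)
    fix s assume "0 < s" "s < t"
    then show "\<exists>y. DERIV (\<lambda>t. (x t \<bullet> x t) * exp ((- 2 * K) * t)) s :> y \<and> y \<le> 0"
      using deriv[of s "- 2 * K"] bound[of s]
      by (intro exI[of _ "(2 * (x s \<bullet> (A s *v x s)) + - 2 * K * (x s \<bullet> x s)) * exp (- 2 * K * s)"])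
         (auto intro!: mult_nonpos_nonneg)
  qed (rule cont)
  then have "(norm (x t) * exp (- (K * t)))\<^sup>2 \<le> (norm (x 0))\<^sup>2"
    by (simp add: dot_square_norm power_mult_distrib mult.assoc flip: exp_double)
  then have "norm (x t) * exp (- (K * t)) \<le> norm (x 0)"
    by (rule power2_le_imp_le) simp
  then show "norm (x t) \<le> exp (K * t) * norm (x 0)"
    by (simp add: exp_minus field_simps)
  have "(x 0 \<bullet> x 0) * exp ((2 * K) * 0) \<le> (x t \<bullet> x t) * exp ((2 * K) * t)"
    using t
  proof (rule DERIV_nonneg_imp_increasing_open)
    fix s assume "0 < s" "s < t"
    then show "\<exists>y. DERIV (\<lambda>t. (x t \<bullet> x t) * exp ((2 * K) * t)) s :> y \<and> y \<ge> 0"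
      using deriv[of s "2 * K"] bound[of s]
      by (intro exI[of _ "(2 * (x s \<bullet> (A s *v x s)) + 2 * K * (x s \<bullet> x s)) * exp (2 * K * s)"])
         (auto intro!: mult_nonneg_nonneg)
  qed (rule cont)
  then have "(norm (x 0))\<^sup>2 \<le> (norm (x t) * exp (K * t))\<^sup>2"
    by (simp add: dot_square_norm power_mult_distrib mult.assoc flip: exp_double)
  then have "norm (x 0) \<le> norm (x t) * exp (K * t)"
    by (rule power2_le_imp_le) simp
  then show "norm (x 0) \<le> exp (K * t) * norm (x t)"
    by (simp add: mult.commute)
qed

section \<open>Uniqueness of solutions and of the Cauchy matrix\<close>

lemma linear_matrix_vector_left: "bounded_linear (\<lambda>M :: real^'n^'m. M *v c)"
  unfolding linear_conv_bounded_linear[symmetric]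
  by (intro linearI) (simp_all add: matrix_vector_mult_add_rdistrib scaleR_matrix_vector_assoc)

lemma linear_matrix_mult_left: "bounded_linear (\<lambda>M :: real^'n^'m. M ** (C :: real^'k^'n))"
  unfolding linear_conv_bounded_linear[symmetric]
  by (intro linearI) (simp_all add: vec_eq_iff matrix_matrix_mult_def sum.distrib
    sum_distrib_left algebra_simps)

lemma fundamental_matrix_mult:
  assumes "fundamental_matrix A X" "invertible C"
  shows "fundamental_matrix A (\<lambda>t. X t ** C)"
proof -
  have "((\<lambda>t. X t ** C) has_vector_derivative A t ** (X t ** C)) (at t within {0..})"
    if "t \<ge> 0" for t
    using bounded_linear.has_vector_derivative[OF linear_matrix_mult_left, of X "A t ** X t" _ C]
      assms(1) that by (simp add: fundamental_matrix_def matrix_mul_assoc)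
  with assms show ?thesis
    by (auto simp: fundamental_matrix_def invertible_mult)
qed

lemma fundamental_matrix_vector:
  assumes "fundamental_matrix A X" "t \<ge> 0"
  shows "((\<lambda>t. X t *v c) has_vector_derivative A t *v (X t *v c)) (at t within {0..})"
  using bounded_linear.has_vector_derivative[OF linear_matrix_vector_left, of X "A t ** X t" _ c]
    assms by (simp add: fundamental_matrix_def matrix_vector_mul_assoc)

lemma bounded_coefficients:
  fixes A :: "real \<Rightarrow> real^'n^'n"
  assumes "bounded (A ` {0..})"
  obtains K where "K \<ge> 0" "\<And>t y. t \<ge> 0 \<Longrightarrow> norm (A t *v y) \<le> K * norm y"
proof -
  obtain B where B: "\<And>t. t \<ge> 0 \<Longrightarrow> norm (A t) \<le> B"
    using assms unfolding bounded_iff by auto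
  have "B \<ge> 0" using B[of 0] norm_ge_zero[of "A 0"] by linarith
  show ?thesis
  proof
    show "real CARD('n) * B \<ge> 0" using \<open>B \<ge> 0\<close> by simp
    fix t :: real and y :: "real^'n" assume "t \<ge> 0"
    then show "norm (A t *v y) \<le> real CARD('n) * B * norm y"
      by (intro order_trans[OF norm_matrix_vector_le] mult_right_mono mult_left_mono B) auto
  qed
qed

lemma invertible_mult_inverse:
  fixes M :: "real^'n^'n"
  assumes "invertible M"
  shows "M ** matrix_inv M = mat 1" "matrix_inv M ** M = mat 1"
  using someI_ex[OF assms[unfolded invertible_def]] by (auto simp: matrix_inv_def)

text \<open>The difference of both sides solves the system and starts at 0, so the exponential bound
  makes it vanish.\<close>

lemma solution_unique:
  assumes A: "bounded (A ` {0..})" and X: "fundamental_matrix A X"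
    and x: "\<And>t. t \<ge> 0 \<Longrightarrow> (x has_vector_derivative A t *v x t) (at t within {0..})"
    and t: "t \<ge> 0"
  shows "x t = X t *v (matrix_inv (X 0) *v x 0)"
proof -
  let ?c = "matrix_inv (X 0) *v x 0"
  obtain K where K: "\<And>t y. t \<ge> 0 \<Longrightarrow> norm (A t *v y) \<le> K * norm y"
    by (rule bounded_coefficients[OF A]) (rule that)
  have "X 0 *v ?c = x 0"
    using X by (simp add: matrix_vector_mul_assoc invertible_mult_inverse fundamental_matrix_def)
  moreover have "norm (x t - X t *v ?c) \<le> exp (K * t) * norm (x 0 - X 0 *v ?c)"
    using x fundamental_matrix_vector[OF X]
    by (intro solution_norm_bounds(1)[where A = A] K t)
       (auto intro!: derivative_eq_intros simp: matrix_vector_mult_diff_distrib)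
  ultimately show ?thesis by simp
qed

lemma fundamental_matrix_unique:
  assumes A: "bounded (A ` {0..})" and X: "fundamental_matrix A X" and Y: "fundamental_matrix A Y"
  obtains C where "invertible C" "\<And>t. t \<ge> 0 \<Longrightarrow> Y t = X t ** C"
proof -
  define C where "C = matrix_inv (X 0) ** Y 0"
  have YC: "Y t = X t ** C" if "t \<ge> 0" for t
  proof -
    have "column j (Y t) = column j (X t ** C)" for j
    proof -
      have "Y t *v axis j 1 = X t *v (matrix_inv (X 0) *v (Y 0 *v axis j 1))"
        using solution_unique[OF A X fundamental_matrix_vector[OF Y] that] by simp
      then show ?thesis
        by (simp add: column_mult C_def matrix_vector_mult_basis flip: matrix_vector_mul_assoc)
    qed
    then show ?thesis
      by (simp add: vec_eq_iff column_def)
  qed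
  have "det (Y 0) \<noteq> 0"
    using Y by (simp add: fundamental_matrix_def flip: invertible_det_nz)
  then have "invertible C"
    using YC[of 0] by (auto simp: det_mul invertible_det_nz)
  with YC show ?thesis by (rule that[rotated])
qed

lemma matrix_inv_mult:
  fixes M C :: "real^'n^'n"
  assumes "invertible M" "invertible C"
  shows "matrix_inv (M ** C) = matrix_inv C ** matrix_inv M"
proof -
  have "matrix_inv (M ** C) = matrix_inv C ** (matrix_inv M ** M) ** C ** matrix_inv (M ** C)"
    using assms by (simp add: invertible_mult_inverse)
  also have "\<dots> = matrix_inv C ** matrix_inv M ** ((M ** C) ** matrix_inv (M ** C))"
    by (simp only: matrix_mul_assoc)
  finally show ?thesis
    using assms by (simp add: invertible_mult_inverse invertible_mult)
qed

text \<open>\<open>strongly_fast_invertible\<close> may supply another fundamental matrix for each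
  \<open>L\<close>; this moves all bounds to the single matrix \<open>Y\<close> of the proof. The
  constant right factor cancels.\<close>

lemma cauchy_matrix_unique:
  assumes A: "bounded (A ` {0..})" and X: "fundamental_matrix A X" and Y: "fundamental_matrix A Y"
    and ts: "t \<ge> 0" "s \<ge> 0"
  shows "cauchy_matrix Y t s = cauchy_matrix X t s"
proof -
  obtain C where C: "invertible C" "\<And>t. t \<ge> 0 \<Longrightarrow> Y t = X t ** C"
    using fundamental_matrix_unique[OF A X Y] by blast
  have "cauchy_matrix Y t s = X t ** (C ** matrix_inv C) ** matrix_inv (X s)"
    using C ts X by (simp add: cauchy_matrix_def matrix_inv_mult fundamental_matrix_def matrix_mul_assoc)
  then show ?thesis
    using C(1) by (simp add: invertible_mult_inverse cauchy_matrix_def)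
qed

section \<open>Characteristic exponents as exponential bounds\<close>

lemma elog_less_iff:
  assumes "r \<ge> 0" "t > 0"
  shows "elog r / ereal t < ereal y \<longleftrightarrow> r < exp (y * t)"
proof (cases "r = 0")
  case True
  then show ?thesis using assms by (simp add: elog_def)
next
  case False
  then have "elog r / ereal t < ereal y \<longleftrightarrow> ln r < y * t"
    using assms by (simp add: elog_def divide_less_eq)
  also have "\<dots> \<longleftrightarrow> r < exp (y * t)"
    using False assms by (metis exp_less_cancel_iff exp_ln less_eq_real_def)
  finally show ?thesis .
qed

lemma less_elog_iff:
  assumes "r > 0" "t > 0"
  shows "ereal y < elog r / ereal t \<longleftrightarrow> exp (y * t) < r"
proof -
  have "ereal y < elog r / ereal t \<longleftrightarrow> y * t < ln r"
    using assms by (simp add: elog_def less_divide_eq)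
  also have "\<dots> \<longleftrightarrow> exp (y * t) < r"
    using assms by (metis exp_less_cancel_iff exp_ln)
  finally show ?thesis .
qed

lemma elog_less_top:
  assumes "t > 0"
  shows "elog r / ereal t < \<infinity>"
  using assms by (simp add: elog_def)

text \<open>Trades upper limits in \<open>ereal\<close> for real estimates. The level
  \<open>y = \<infinity>\<close> is covered by \<open>top\<close>, and
  \<open>y = -\<infinity>\<close> never exceeds \<open>\<mu>\<close>.\<close>

lemma char_exponent_le_iff:
  "char_exponent x \<le> \<mu> \<longleftrightarrow>
    (\<forall>\<nu>::real. \<mu> < ereal \<nu> \<longrightarrow> eventually (\<lambda>t. norm (x t) < exp (\<nu> * t)) at_top)"
proof -
  have *: "eventually (\<lambda>t. elog (norm (x t)) / ereal t < ereal \<nu>) at_top \<longleftrightarrow>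
      eventually (\<lambda>t. norm (x t) < exp (\<nu> * t)) at_top" for \<nu>
    by (rule eventually_subst, rule eventually_mono[OF eventually_gt_at_top[of 0]])
       (simp add: elog_less_iff)
  have top: "eventually (\<lambda>t. elog (norm (x t)) / ereal t < \<infinity>) at_top"
    by (rule eventually_mono[OF eventually_gt_at_top[of 0]]) (rule elog_less_top)
  have "char_exponent x \<le> \<mu> \<longleftrightarrow>
      (\<forall>y>\<mu>. eventually (\<lambda>t. elog (norm (x t)) / ereal t < y) at_top)"
    unfolding char_exponent_def by (rule Limsup_le_iff)
  also have "\<dots> \<longleftrightarrow> (\<forall>\<nu>::real. \<mu> < ereal \<nu> \<longrightarrow>
      eventually (\<lambda>t. elog (norm (x t)) / ereal t < ereal \<nu>) at_top)"
  proof (intro iffI allI impI)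
    fix y assume r: "\<forall>\<nu>::real. \<mu> < ereal \<nu> \<longrightarrow>
      eventually (\<lambda>t. elog (norm (x t)) / ereal t < ereal \<nu>) at_top" and y: "\<mu> < y"
    show "eventually (\<lambda>t. elog (norm (x t)) / ereal t < y) at_top"
      using r y top by (cases y) auto
  qed auto
  finally show ?thesis by (simp add: *)
qed

text \<open>Absorbs constant factors into an arbitrarily small increase of the exponent.\<close>

lemma eventually_mult_exp_le:
  fixes c \<nu> \<nu>' :: real
  assumes "\<nu>' < \<nu>"
  shows "eventually (\<lambda>t. c * exp (\<nu>' * t) < exp (\<nu> * t)) at_top"
proof -
  have "filterlim (\<lambda>t. exp ((\<nu> - \<nu>') * t)) at_top at_top"
    using assms
    by (intro filterlim_compose[OF exp_at_top]
        filterlim_tendsto_pos_mult_at_top[OF tendsto_const _ filterlim_ident]) auto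
  then have "eventually (\<lambda>t. c < exp ((\<nu> - \<nu>') * t)) at_top"
    by (simp add: filterlim_at_top_dense)
  then show ?thesis
  proof (rule eventually_mono)
    fix t assume "c < exp ((\<nu> - \<nu>') * t)"
    then have "c * exp (\<nu>' * t) < exp ((\<nu> - \<nu>') * t) * exp (\<nu>' * t)" by simp
    then show "c * exp (\<nu>' * t) < exp (\<nu> * t)"
      by (simp add: algebra_simps flip: exp_add)
  qed
qed

section \<open>Solutions in coordinates and their filtration by exponents\<close>

locale bounded_system =
  fixes A X :: "real \<Rightarrow> real^'n^'n"
  assumes bounded_A: "bounded (A ` {0..})" and fundamental_X: "fundamental_matrix A X"
begin

definition sol :: "real^'n \<Rightarrow> real \<Rightarrow> real^'n" where
  "sol c = (\<lambda>t. if t < 0 then 0 else X t *v c)"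

definition ch :: "real^'n \<Rightarrow> ereal" where
  "ch c = char_exponent (sol c)"

lemma sol_add: "sol (x + y) = sol x + sol y"
  by (rule ext) (simp add: sol_def matrix_vector_right_distrib)

lemma sol_scale: "sol (c *\<^sub>R x) = (\<lambda>t. c *\<^sub>R sol x t)"
  by (rule ext) (simp add: sol_def matrix_vector_mult_scaleR)

lemma inj_sol: "inj sol"
proof (rule injI)
  fix x y assume "sol x = sol y"
  then have "sol x 0 = sol y 0" by simp
  then have "X 0 *v x = X 0 *v y"
    by (simp add: sol_def)
  then have "matrix_inv (X 0) ** X 0 *v x = matrix_inv (X 0) ** X 0 *v y"
    by (simp flip: matrix_vector_mul_assoc)
  then show "x = y"
    using fundamental_X by (simp add: invertible_mult_inverse fundamental_matrix_def)
qed

lemma sol_deriv: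
  assumes "t \<ge> 0"
  shows "(sol c has_vector_derivative A t *v sol c t) (at t within {0..})"
proof (rule has_vector_derivative_transform)
  show "((\<lambda>t. X t *v c) has_vector_derivative A t *v sol c t) (at t within {0..})"
    using fundamental_matrix_vector[OF fundamental_X assms, of c] assms by (simp add: sol_def)
qed (use assms in \<open>auto simp: sol_def\<close>)

lemma sol_0: "sol 0 = 0"
  by (rule ext) (simp add: sol_def)

lemma solutions_eq: "solutions A = range sol"
proof
  have "sol c \<in> solutions A" for c
    unfolding solutions_def mem_Collect_eq
    by (intro conjI allI impI, rule sol_deriv) (simp_all add: sol_def)
  then show "range sol \<subseteq> solutions A" by blast
  show "solutions A \<subseteq> range sol"
  proof
    fix x assume x: "x \<in> solutions A"
    have "x t = sol (matrix_inv (X 0) *v x 0) t" for t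
    proof (cases "t < 0")
      case False
      then show ?thesis
        using x solution_unique[OF bounded_A fundamental_X, of x t]
        by (simp add: solutions_def sol_def)
    qed (use x in \<open>simp add: solutions_def sol_def\<close>)
    then have "x = sol (matrix_inv (X 0) *v x 0)" by (rule ext)
    then show "x \<in> range sol" by (rule range_eqI)
  qed
qed

lemma ch_le_iff:
  "ch c \<le> \<mu> \<longleftrightarrow> (\<forall>\<nu>::real. \<mu> < ereal \<nu> \<longrightarrow> eventually (\<lambda>t. norm (X t *v c) < exp (\<nu> * t)) at_top)"
proof -
  have *: "eventually (\<lambda>t. norm (sol c t) < exp (\<nu> * t)) at_top \<longleftrightarrow>
      eventually (\<lambda>t. norm (X t *v c) < exp (\<nu> * t)) at_top" for \<nu>
    by (rule eventually_subst, rule eventually_mono[OF eventually_gt_at_top[of 0]])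
       (simp add: sol_def)
  show ?thesis
    unfolding ch_def char_exponent_le_iff * ..
qed

lemma ch_0: "ch 0 = -\<infinity>"
proof -
  have "ch 0 \<le> -\<infinity>"
    unfolding ch_le_iff by simp
  then show ?thesis by simp
qed

lemma ch_add: "ch (x + y) \<le> max (ch x) (ch y)"
  unfolding ch_le_iff[of "x + y"]
proof (intro allI impI)
  fix \<nu> :: real assume "max (ch x) (ch y) < ereal \<nu>"
  then obtain \<nu>' where "max (ch x) (ch y) < \<nu>'" "\<nu>' < ereal \<nu>"
    using dense by blast
  then obtain r where r: "max (ch x) (ch y) < ereal r" "r < \<nu>"
    by (cases \<nu>') auto
  have "eventually (\<lambda>t. norm (X t *v x) < exp (r * t)) at_top"
    "eventually (\<lambda>t. norm (X t *v y) < exp (r * t)) at_top"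
    using ch_le_iff[of x "ch x"] ch_le_iff[of y "ch y"] r(1) by auto
  then show "eventually (\<lambda>t. norm (X t *v (x + y)) < exp (\<nu> * t)) at_top"
    using eventually_mult_exp_le[OF r(2), of 2]
  proof eventually_elim
    case (elim t)
    then show ?case
      using norm_triangle_ineq[of "X t *v x" "X t *v y"] by (simp add: matrix_vector_right_distrib)
  qed
qed

lemma ch_scale: "ch (a *\<^sub>R x) \<le> ch x"
  unfolding ch_le_iff[of "a *\<^sub>R x"]
proof (intro allI impI)
  fix \<nu> :: real assume "ch x < ereal \<nu>"
  then obtain \<nu>' where "ch x < \<nu>'" "\<nu>' < ereal \<nu>"
    using dense by blast
  then obtain r where r: "ch x < ereal r" "r < \<nu>"
    by (cases \<nu>') auto
  have "eventually (\<lambda>t. norm (X t *v x) < exp (r * t)) at_top"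
    using ch_le_iff[of x "ch x"] r(1) by auto
  then show "eventually (\<lambda>t. norm (X t *v (a *\<^sub>R x)) < exp (\<nu> * t)) at_top"
    using eventually_mult_exp_le[OF r(2), of "\<bar>a\<bar>"]
  proof eventually_elim
    case (elim t)
    have "\<bar>a\<bar> * norm (X t *v x) \<le> \<bar>a\<bar> * exp (r * t)"
      using elim(1) by (intro mult_left_mono) auto
    then show ?case
      using elim(2) by (simp add: matrix_vector_mult_scaleR)
  qed
qed

lemma subspace_ch_le: "subspace {c. ch c \<le> \<mu>}"
  unfolding subspace_def
  by (auto simp: ch_0 intro: order_trans[OF ch_add] order_trans[OF ch_scale])

lemma subspace_ch_less: "\<mu> > -\<infinity> \<Longrightarrow> subspace {c. ch c < \<mu>}"
  unfolding subspace_def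
  by (auto simp: ch_0 intro: le_less_trans[OF ch_add] le_less_trans[OF ch_scale])

text \<open>Bounded coefficients confine a nonzero solution between multiples of
  \<open>exp (- K * t)\<close> and \<open>exp (K * t)\<close>.\<close>

lemma ch_real:
  assumes "c \<noteq> 0"
  shows "\<bar>ch c\<bar> \<noteq> \<infinity>"
proof -
  obtain K where K: "\<And>t y. t \<ge> 0 \<Longrightarrow> norm (A t *v y) \<le> K * norm y"
    by (rule bounded_coefficients[OF bounded_A]) (rule that)
  have upper: "norm (X t *v c) \<le> exp (K * t) * norm (X 0 *v c)" if "t \<ge> 0" for t
    by (rule solution_norm_bounds(1)[where A = A])
       (use fundamental_matrix_vector[OF fundamental_X] K that in blast)+
  have lower: "norm (X 0 *v c) \<le> exp (K * t) * norm (X t *v c)" if "t \<ge> 0" for t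
    by (rule solution_norm_bounds(2)[where A = A])
       (use fundamental_matrix_vector[OF fundamental_X] K that in blast)+
  have X0: "norm (X 0 *v c) > 0"
  proof -
    have "matrix_inv (X 0) *v (X 0 *v c) = c"
      using fundamental_X
      by (simp add: matrix_vector_mul_assoc invertible_mult_inverse fundamental_matrix_def)
    then have "X 0 *v c \<noteq> 0"
      using assms by auto
    then show ?thesis by simp
  qed
  have "ch c \<le> ereal K"
    unfolding ch_le_iff
  proof (intro allI impI)
    fix \<nu> assume "ereal K < ereal \<nu>"
    then have "eventually (\<lambda>t. norm (X 0 *v c) * exp (K * t) < exp (\<nu> * t)) at_top"
      by (intro eventually_mult_exp_le) simp
    then show "eventually (\<lambda>t. norm (X t *v c) < exp (\<nu> * t)) at_top"
      using eventually_ge_at_top[of 0]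
    proof eventually_elim
      case (elim t)
      then show ?case using upper[of t] by (simp add: mult.commute)
    qed
  qed
  moreover have "ch c \<noteq> -\<infinity>"
  proof
    assume "ch c = -\<infinity>"
    then have "ch c \<le> -\<infinity>" by simp
    \<comment> \<open>Any rate below \<open>- K\<close> contradicts \<open>lower\<close>; with
      \<open>- K - 1\<close> the factor \<open>exp (- t)\<close> remains, which tends to 0.\<close>
    then have "eventually (\<lambda>t. norm (X t *v c) < exp ((- K - 1) * t)) at_top"
      unfolding ch_le_iff by (elim allE[of _ "- K - 1"]) simp
    moreover have "eventually (\<lambda>t. 1 / norm (X 0 *v c) * exp (-1 * t) < exp (0 * t)) at_top"
      by (rule eventually_mult_exp_le) simp
    ultimately have "eventually (\<lambda>t::real. False) at_top"
      using eventually_ge_at_top[of 0]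
    proof eventually_elim
      case (elim t)
      have "norm (X 0 *v c) \<le> exp (K * t) * norm (X t *v c)"
        using lower elim by blast
      also have "\<dots> \<le> exp (K * t) * exp ((- K - 1) * t)"
        using elim by (intro mult_left_mono) auto
      also have "\<dots> = exp (- t)"
        unfolding exp_add[symmetric] by (simp add: left_diff_distrib)
      finally have "norm (X 0 *v c) \<le> exp (- t)" .
      moreover have "exp (- t) < norm (X 0 *v c)"
        using elim(2) X0 by (simp add: divide_less_eq)
      ultimately show False by simp
    qed
    then show False by simp
  qed
  ultimately show ?thesis by (cases "ch c") auto
qed

lemma exponents_eq: "char_exponent ` (solutions A - {0}) = ch ` (UNIV - {0})"
proof -
  have "solutions A - {0} = sol ` UNIV - sol ` {0}"
    by (simp add: solutions_eq sol_0)
  also have "\<dots> = sol ` (UNIV - {0})"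
    by (rule image_set_diff[OF inj_sol, symmetric])
  finally show ?thesis
    by (simp add: image_image ch_def)
qed

text \<open>The spaces \<open>{c. ch c \<le> \<mu>}\<close> grow strictly at every exponent, so
  their dimension determines it. Finiteness matters because \<open>sorted_list_of_set\<close> maps
  infinite sets to the empty list.\<close>

lemma finite_exponents: "finite (ch ` (UNIV - {0}))"
proof (rule inj_on_finite)
  let ?d = "\<lambda>\<mu>. dim {c. ch c \<le> \<mu>}"
  have less: "?d \<mu> < ?d (ch c)" if "\<mu> < ch c" for \<mu> c
  proof (rule dim_psubset)
    have "{c. ch c \<le> \<mu>} \<subset> {c'. ch c' \<le> ch c}"
    proof
      show "{c. ch c \<le> \<mu>} \<subseteq> {c'. ch c' \<le> ch c}"
        using that by (auto intro: order_trans less_imp_le)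
      show "{c. ch c \<le> \<mu>} \<noteq> {c'. ch c' \<le> ch c}"
        using that by (metis mem_Collect_eq not_le order_refl)
    qed
    then show "span {c. ch c \<le> \<mu>} \<subset> span {c'. ch c' \<le> ch c}"
      by (simp add: subspace_ch_le span_eq_iff[THEN iffD2])
  qed
  show "inj_on ?d (ch ` (UNIV - {0}))"
  proof (rule inj_onI)
    fix \<mu> \<mu>' assume *: "\<mu> \<in> ch ` (UNIV - {0})" "\<mu>' \<in> ch ` (UNIV - {0})" "?d \<mu> = ?d \<mu>'"
    then obtain c c' where "\<mu> = ch c" "\<mu>' = ch c'" by blast
    then show "\<mu> = \<mu>'"
      using less[of \<mu> c'] less[of \<mu>' c] *(3) by (cases \<mu> \<mu>' rule: linorder_cases) auto
  qed
  show "?d ` ch ` (UNIV - {0}) \<subseteq> {..CARD('n)}"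
    using dim_subset_UNIV_cart by auto
qed simp

definition spectrum :: "ereal list" where
  "spectrum = rev (sorted_list_of_set (ch ` (UNIV - {0})))"

lemma lyapunov_exponents_eq: "lyapunov_exponents A = spectrum"
  by (simp only: lyapunov_exponents_def exponents_eq spectrum_def)

lemma set_spectrum: "set spectrum = ch ` (UNIV - {0})"
  using finite_exponents by (simp add: spectrum_def)

lemma spectrum_less:
  assumes "k < l" "l < length spectrum"
  shows "spectrum ! l < spectrum ! k"
proof -
  have "sorted (rev spectrum)" "distinct spectrum"
    by (simp_all add: spectrum_def)
  then have "spectrum ! l \<le> spectrum ! k" "spectrum ! l \<noteq> spectrum ! k"
    using assms by (auto intro: sorted_rev_nth_mono simp: nth_eq_iff_index_eq)
  then show ?thesis by simp
qed

lemma ch_le_spectrum_0: "ch c \<le> spectrum ! 0"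
proof (cases "c = 0")
  case True
  then show ?thesis by (simp add: ch_0)
next
  case False
  then have "ch c \<in> set spectrum"
    by (simp add: set_spectrum)
  then obtain i where i: "i < length spectrum" "ch c = spectrum ! i"
    by (metis in_set_conv_nth)
  then show ?thesis
    using spectrum_less[of 0 i] by (cases i) auto
qed

definition slow :: "nat \<Rightarrow> (real^'n) set" where
  "slow i = (if i \<le> length spectrum then {c. ch c \<le> spectrum ! (i - 1)} else {0})"

lemma dim_lyapunov_space: "fun_vs.dim (lyapunov_space A i) = dim (slow i)"
proof -
  have "lyapunov_space A i = sol ` slow i"
    by (auto simp: lyapunov_space_def slow_def lyapunov_exponents_eq lyapunov_exponent_def
        solutions_eq ch_def sol_0)
  then show ?thesis
    using dim_fun_image[OF sol_add sol_scale inj_sol] by simp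
qed

text \<open>The dimensions telescope: from \<open>{0}\<close> behind the last exponent they grow by
  1 per step, up to the whole space at index 1.\<close>

lemma length_spectrum:
  assumes "simple_spectrum A"
  shows "length spectrum = CARD('n)"
proof -
  let ?p = "length spectrum"
  have one: "dim (slow i) - dim (slow (Suc i)) = 1" if "i \<in> {1..?p}" for i
    using assms that
    by (simp add: simple_spectrum_def lyapunov_mult_def dim_lyapunov_space lyapunov_exponents_eq)
  have dim: "dim (slow (Suc ?p - j)) = j" if "j \<le> ?p" for j
    using that
  proof (induction j)
    case 0
    then show ?case by (simp add: slow_def)
  next
    case (Suc j)
    then have "dim (slow (?p - j)) - dim (slow (Suc (?p - j))) = 1"
      by (intro one) auto
    then show ?case using Suc by (simp add: Suc_diff_le)
  qed
  \<comment> \<open>For an empty spectrum \<open>slow 1\<close> would be the default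
    \<open>{0}\<close>; a nonzero vector excludes this.\<close>
  have "axis undefined 1 \<in> UNIV - {0 :: real^'n}"
    by (simp add: axis_eq_0_iff)
  then have "set spectrum \<noteq> {}"
    unfolding set_spectrum by blast
  then have "1 \<le> ?p" by (cases spectrum) auto
  then have "slow 1 = UNIV"
    using ch_le_spectrum_0 by (auto simp: slow_def)
  then show ?thesis
    using dim[of ?p] by simp
qed

text \<open>With multiplicities 1 and finite exponents the lower limit is a real number, and every
  smaller rate is eventually exceeded.\<close>

lemma regular_det:
  assumes "simple_spectrum A"
    and "(\<Sum>i = 1..length (lyapunov_exponents A).
          ereal (real (lyapunov_mult A i)) * lyapunov_exponent A i) =
       Liminf at_top (\<lambda>t. elog \<bar>det (X t)\<bar> / ereal t)"
    and \<nu>: "\<nu> < (\<Sum>i = 1..CARD('n). real_of_ereal (spectrum ! (i - 1)))"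
  shows "eventually (\<lambda>t. exp (\<nu> * t) < \<bar>det (X t)\<bar>) at_top"
proof -
  have real: "ereal (real_of_ereal (spectrum ! (i - 1))) = spectrum ! (i - 1)"
    if "i \<in> {1..CARD('n)}" for i
  proof -
    have "spectrum ! (i - 1) \<in> set spectrum"
      using that length_spectrum[OF assms(1)] by auto
    then obtain c where "c \<noteq> 0" "spectrum ! (i - 1) = ch c"
      unfolding set_spectrum by blast
    then show ?thesis
      using ch_real[of c] by (simp add: ereal_real)
  qed
  have "Liminf at_top (\<lambda>t. elog \<bar>det (X t)\<bar> / ereal t) =
      (\<Sum>i = 1..CARD('n). ereal (real_of_ereal (spectrum ! (i - 1))))"
    unfolding assms(2)[symmetric] lyapunov_exponents_eq length_spectrum[OF assms(1)]
  proof (rule sum.cong)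
    fix i assume i: "i \<in> {1..CARD('n)}"
    then have "lyapunov_mult A i = 1"
      using assms(1) length_spectrum[OF assms(1)]
      unfolding simple_spectrum_def lyapunov_exponents_eq by simp
    then show "ereal (real (lyapunov_mult A i)) * lyapunov_exponent A i =
        ereal (real_of_ereal (spectrum ! (i - 1)))"
      unfolding lyapunov_exponent_def lyapunov_exponents_eq real[OF i] by simp
  qed simp
  also have "\<dots> = ereal (\<Sum>i = 1..CARD('n). real_of_ereal (spectrum ! (i - 1)))"
    by (rule sum_ereal)
  finally have "ereal \<nu> < Liminf at_top (\<lambda>t. elog \<bar>det (X t)\<bar> / ereal t)"
    using \<nu> by (simp only: less_ereal.simps)
  from less_LiminfD[OF this] show ?thesis
    using eventually_gt_at_top[of 0]
  proof eventually_elim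
    case (elim t)
    have "\<bar>det (X t)\<bar> > 0"
      using fundamental_X elim(2) by (simp add: fundamental_matrix_def invertible_det_nz)
    then show ?case
      using elim less_elog_iff by blast
  qed
qed

end

text \<open>One solution is chosen for each exponent. Distinct exponents force independence: in a
  vanishing combination, the fastest solution occurring would be a combination of slower
  ones.\<close>

lemma regular_normal_basis:
  fixes A :: "real \<Rightarrow> real^'n^'n" and e :: "nat \<Rightarrow> 'n"
  assumes A: "bounded (A ` {0..})" and regular: "regular_system A" and simple: "simple_spectrum A"
    and e: "bij_betw e {1..CARD('n)} UNIV"
  obtains Y \<mu> where "fundamental_matrix A Y"
    "\<And>k l. 1 \<le> k \<Longrightarrow> k < l \<Longrightarrow> l \<le> CARD('n) \<Longrightarrow> \<mu> (e l) < \<mu> (e k)"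
    "\<And>a \<nu>. \<mu> a < \<nu> \<Longrightarrow> eventually (\<lambda>t. norm (column a (Y t)) < exp (\<nu> * t)) at_top"
    "\<And>\<nu>. \<nu> < sum \<mu> UNIV \<Longrightarrow> eventually (\<lambda>t. exp (\<nu> * t) < \<bar>det (Y t)\<bar>) at_top"
proof -
  obtain X where X: "fundamental_matrix A X"
    "(\<Sum>i = 1..length (lyapunov_exponents A).
          ereal (real (lyapunov_mult A i)) * lyapunov_exponent A i) =
       Liminf at_top (\<lambda>t. elog \<bar>det (X t)\<bar> / ereal t)"
    using regular unfolding regular_system_def by blast
  interpret bounded_system A X
    by unfold_locales (use A X in auto)
  note len = length_spectrum[OF simple]
  have "\<exists>c. c \<noteq> 0 \<and> ch c = spectrum ! (k - 1)" if "k \<in> {1..CARD('n)}" for k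
  proof -
    have "spectrum ! (k - 1) \<in> set spectrum"
      using that len by auto
    then show ?thesis unfolding set_spectrum by auto
  qed
  then obtain c where c: "\<And>k. k \<in> {1..CARD('n)} \<Longrightarrow> c k \<noteq> 0 \<and> ch (c k) = spectrum ! (k - 1)"
    by metis
  define ix where "ix = inv_into {1..CARD('n)} e"
  have ix_e: "ix (e k) = k" if "k \<in> {1..CARD('n)}" for k
    unfolding ix_def using that bij_betw_imp_inj_on[OF e] by simp
  have ix: "ix a \<in> {1..CARD('n)}" "e (ix a) = a" for a
  proof -
    have "a \<in> e ` {1..CARD('n)}"
      using bij_betw_imp_surj_on[OF e] by simp
    then show "ix a \<in> {1..CARD('n)}" "e (ix a) = a"
      unfolding ix_def by (rule inv_into_into, rule f_inv_into_f)
  qed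
  define \<mu> where "\<mu> a = real_of_ereal (spectrum ! (ix a - 1))" for a
  have ch_c: "ch (c (ix a)) = ereal (\<mu> a)" for a
    using c[OF ix(1)[of a]] ch_real[of "c (ix a)"] by (simp add: \<mu>_def ereal_real)
  have \<mu>_less: "\<mu> (e l) < \<mu> (e k)" if "1 \<le> k" "k < l" "l \<le> CARD('n)" for k l
  proof -
    have "ereal (\<mu> (e l)) < ereal (\<mu> (e k))"
      using spectrum_less[of "k - 1" "l - 1"] that len c[of k] c[of l]
      by (simp add: ix_e flip: ch_c)
    then show ?thesis by simp
  qed
  define C where "C = (\<chi> i a. c (ix a) $ i)"
  have col: "column a C = c (ix a)" for a
    by (simp add: column_def C_def vec_eq_iff)
  have "w a = 0" if w: "(\<Sum>a\<in>UNIV. w a *s column a C) = 0" for w a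
  proof (rule ccontr)
    assume "w a \<noteq> 0"
    then have "\<exists>k. k \<in> {1..CARD('n)} \<and> w (e k) \<noteq> 0"
      using ix by metis
    \<comment> \<open>The least index with nonzero weight belongs to the largest exponent.\<close>
    define k where "k = (LEAST k. k \<in> {1..CARD('n)} \<and> w (e k) \<noteq> 0)"
    have k: "k \<in> {1..CARD('n)}" "w (e k) \<noteq> 0"
      using LeastI_ex[OF \<open>\<exists>k. _\<close>] by (auto simp: k_def)
    have least: "k \<le> l" if "l \<in> {1..CARD('n)}" "w (e l) \<noteq> 0" for l
      unfolding k_def using that by (intro Least_le) auto
    let ?T = "{x. ch x < ereal (\<mu> (e k))}"
    have T: "subspace ?T"
      by (rule subspace_ch_less) simp
    have "w b *s column b C \<in> ?T" if "b \<noteq> e k" for b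
    proof (cases "w b = 0")
      case True
      then show ?thesis by (simp add: ch_0)
    next
      case False
      have "k \<noteq> ix b" using that ix(2)[of b] by metis
      then have "k < ix b"
        using least[of "ix b"] False ix[of b] by simp
      then have "\<mu> b < \<mu> (e k)"
        using \<mu>_less[of k "ix b"] k(1) ix[of b] by simp
      then have "column b C \<in> ?T"
        by (simp add: col ch_c)
      then show ?thesis
        using subspace_mul[OF T, of "column b C" "w b"] by (simp add: scalar_mult_eq_scaleR)
    qed
    then have "(\<Sum>b\<in>UNIV - {e k}. w b *s column b C) \<in> ?T"
      by (intro subspace_sum[OF T]) auto
    moreover have "w (e k) *s column (e k) C = - (\<Sum>b\<in>UNIV - {e k}. w b *s column b C)"
      using w by (simp add: sum.remove[of UNIV "e k"] eq_neg_iff_add_eq_0)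
    ultimately have "w (e k) *s column (e k) C \<in> ?T"
      using subspace_neg[OF T] by metis
    from subspace_mul[OF T this, of "inverse (w (e k))"] have "column (e k) C \<in> ?T"
      using k(2) by (simp add: scalar_mult_eq_scaleR)
    then show False
      by (simp add: col ch_c)
  qed
  then have C: "invertible C"
    unfolding invertible_left_inverse matrix_left_invertible_independent_columns by blast
  have "eventually (\<lambda>t. norm (column a (X t ** C)) < exp (\<nu> * t)) at_top" if "\<mu> a < \<nu>" for a \<nu>
  proof -
    have "ch (column a C) \<le> ereal (\<mu> a)"
      by (simp add: col ch_c)
    then show ?thesis
      unfolding ch_le_iff column_mult using that by simp
  qed
  note upper = this
  have lower: "eventually (\<lambda>t. exp (\<nu> * t) < \<bar>det (X t ** C)\<bar>) at_top" if \<nu>: "\<nu> < sum \<mu> UNIV" for \<nu>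
  proof -
    have "sum \<mu> UNIV = (\<Sum>i = 1..CARD('n). \<mu> (e i))"
      by (rule sum.reindex_bij_betw[OF e, symmetric])
    also have "\<dots> = (\<Sum>i = 1..CARD('n). real_of_ereal (spectrum ! (i - 1)))"
      by (intro sum.cong) (auto simp: \<mu>_def ix_e)
    finally have sum: "sum \<mu> UNIV = (\<Sum>i = 1..CARD('n). real_of_ereal (spectrum ! (i - 1)))" .
    \<comment> \<open>The gap between \<open>\<nu>\<close> and \<open>\<nu>'\<close> absorbs the
      constant factor \<open>\<bar>det C\<bar>\<close>.\<close>
    obtain \<nu>' where \<nu>': "\<nu> < \<nu>'" "\<nu>' < sum \<mu> UNIV"
      using dense[OF \<nu>] by blast
    have "\<bar>det C\<bar> > 0"
      using C by (simp add: invertible_det_nz)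
    have "eventually (\<lambda>t. exp (\<nu>' * t) < \<bar>det (X t)\<bar>) at_top"
      by (rule regular_det[OF simple X(2)]) (use \<nu>'(2) sum in simp)
    moreover have "eventually (\<lambda>t. 1 / \<bar>det C\<bar> * exp (\<nu> * t) < exp (\<nu>' * t)) at_top"
      by (rule eventually_mult_exp_le[OF \<nu>'(1)])
    ultimately show ?thesis
    proof eventually_elim
      case (elim t)
      then have "1 / \<bar>det C\<bar> * exp (\<nu> * t) < \<bar>det (X t)\<bar>" by simp
      then show ?case
        using \<open>\<bar>det C\<bar> > 0\<close> by (simp add: det_mul abs_mult field_simps)
    qed
  qed
  show ?thesis
    by (rule that[of "\<lambda>t. X t ** C" \<mu>, OF fundamental_matrix_mult[OF X(1) C] \<mu>_less upper lower])
qed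

section \<open>Growth of columns and singular values\<close>

lemma cauchy_matrix_mult:
  assumes "fundamental_matrix A X" "s \<ge> 0"
  shows "cauchy_matrix X t s ** X s = X t"
proof -
  have "cauchy_matrix X t s ** X s = X t ** (matrix_inv (X s) ** X s)"
    by (simp add: cauchy_matrix_def matrix_mul_assoc)
  then show ?thesis
    using assms by (simp add: invertible_mult_inverse fundamental_matrix_def)
qed

lemma invertible_cauchy_matrix:
  assumes "fundamental_matrix A X" "t \<ge> 0" "s \<ge> 0"
  shows "invertible (cauchy_matrix X t s)"
proof -
  have "det (cauchy_matrix X t s) * det (X s) \<noteq> 0"
    using cauchy_matrix_mult[OF assms(1,3), of t] assms(1,2)
    by (simp add: fundamental_matrix_def invertible_det_nz flip: det_mul)
  then show ?thesis by (simp add: invertible_det_nz)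
qed

lemma continuous_on_fundamental_matrix:
  assumes "fundamental_matrix A X"
  shows "continuous_on {0..} X"
  using assms unfolding fundamental_matrix_def continuous_on_eq_continuous_within
  by (auto intro: has_vector_derivative_continuous)

lemma continuous_on_minor:
  assumes "continuous_on T X"
  shows "continuous_on T (\<lambda>t. minor S h g (X t))"
proof -
  have *: "continuous_on T (\<lambda>t. if a \<in> S \<and> b \<in> S then X t $ h a $ g b else if a = b then 1 else 0)"
    for a b
    using assms by (cases "a \<in> S \<and> b \<in> S") (auto intro!: continuous_on_component)
  show ?thesis
    unfolding minor_def det_def by (simp, intro continuous_intros *)
qed

lemma continuous_on_vol: "continuous_on T X \<Longrightarrow> continuous_on T (\<lambda>t. vol S (X t))"
  unfolding vol_def by (intro continuous_intros continuous_on_minor)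

text \<open>Turns asymptotic estimates into estimates for all \<open>t \<ge> 0\<close>, by
  compactness of the remaining interval.\<close>

lemma bounded_above_on_half_line:
  fixes f :: "real \<Rightarrow> real"
  assumes "continuous_on {0..} f" "eventually (\<lambda>t. f t \<le> c) at_top"
  obtains C where "\<And>t. t \<ge> 0 \<Longrightarrow> f t \<le> C"
proof -
  obtain T where T: "\<And>t. t \<ge> T \<Longrightarrow> f t \<le> c"
    using assms(2) unfolding eventually_at_top_linorder by blast
  have "compact (f ` {0..max 0 T})"
    by (intro compact_continuous_image continuous_on_subset[OF assms(1)]) auto
  then have "bdd_above (f ` {0..max 0 T})"
    by (intro bounded_imp_bdd_above compact_imp_bounded)
  then obtain C where C: "\<And>t. t \<in> {0..max 0 T} \<Longrightarrow> f t \<le> C"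
    unfolding bdd_above_def by blast
  show ?thesis
  proof (rule that)
    fix t :: real assume "t \<ge> 0"
    then show "f t \<le> max c C"
      using T[of t] C[of t] by (cases "t \<ge> T") (auto simp: le_max_iff_disj)
  qed
qed

lemma sum_abs_minor_mult_right_le:
  fixes M B :: "real^'n^'n"
  assumes "\<And>i j. \<bar>B $ i $ j\<bar> \<le> m" "m \<ge> 1"
  shows "(\<Sum>g\<in>UNIV. \<bar>minor S h g (M ** B)\<bar>) \<le>
    real CARD('n \<Rightarrow> 'n) * m ^ CARD('n) * (\<Sum>g\<in>UNIV. \<bar>minor S h g M\<bar>)"
proof -
  have "\<bar>minor S h g (M ** B)\<bar> \<le> m ^ CARD('n) * (\<Sum>f\<in>UNIV. \<bar>minor S h f M\<bar>)" for g
  proof -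
    have "minor S h g (M ** B) = minor S g h (transpose B ** transpose M)"
      by (metis matrix_transpose_mul minor_transpose)
    moreover have "\<bar>minor S g h (transpose B ** transpose M)\<bar> \<le>
        m ^ CARD('n) * (\<Sum>f\<in>UNIV. \<bar>minor S f h (transpose M)\<bar>)"
      using assms by (intro minor_mult_left_le) (auto simp: transpose_def)
    ultimately show ?thesis by (simp add: minor_transpose)
  qed
  then have "(\<Sum>g\<in>UNIV. \<bar>minor S h g (M ** B)\<bar>) \<le>
      (\<Sum>g\<in>(UNIV::('n \<Rightarrow> 'n) set). m ^ CARD('n) * (\<Sum>f\<in>UNIV. \<bar>minor S h f M\<bar>))"
    by (rule sum_mono)
  then show ?thesis by simp
qed

lemma matrix_entries_bounded:
  fixes B :: "real^'n^'n"
  obtains m where "m \<ge> 1" "\<And>i j. \<bar>B $ i $ j\<bar> \<le> m"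
proof (rule that[of "max 1 (norm B)"])
  fix i j
  have "\<bar>B $ i $ j\<bar> \<le> norm (B $ i)"
    by (rule component_le_norm_cart)
  also have "\<dots> \<le> norm B"
    by (rule Finite_Cartesian_Product.norm_nth_le)
  finally show "\<bar>B $ i $ j\<bar> \<le> max 1 (norm B)" by simp
qed simp

text \<open>The columns are bounded by their exponents only from above; \<open>det_lower\<close> is
  the sole lower bound, and \<open>\<mu>_less\<close> expresses the simple spectrum.\<close>

locale normal_system = column_order e for e :: "nat \<Rightarrow> 'n::finite" +
  fixes A Y :: "real \<Rightarrow> real^'n^'n" and \<mu> :: "'n \<Rightarrow> real"
  assumes bounded_A: "bounded (A ` {0..})"
    and fundamental_Y: "fundamental_matrix A Y"
    and \<mu>_less: "\<And>k l. 1 \<le> k \<Longrightarrow> k < l \<Longrightarrow> l \<le> CARD('n) \<Longrightarrow> \<mu> (e l) < \<mu> (e k)"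
    and column_upper: "\<And>a \<nu>. \<mu> a < \<nu> \<Longrightarrow>
      eventually (\<lambda>t. norm (column a (Y t)) < exp (\<nu> * t)) at_top"
    and det_lower: "\<And>\<nu>. \<nu> < sum \<mu> UNIV \<Longrightarrow>
      eventually (\<lambda>t. exp (\<nu> * t) < \<bar>det (Y t)\<bar>) at_top"
begin

lemma vol_Y_pos:
  assumes "t \<ge> 0"
  shows "vol S (Y t) > 0"
proof (rule ccontr)
  assume "\<not> ?thesis"
  then have "vol S (Y t) = 0"
    using vol_nonneg[of S "Y t"] by linarith
  then have "det (Y t) = 0"
    using abs_det_le_vol_columns[of "Y t" S] by simp
  then show False
    using fundamental_Y assms by (simp add: fundamental_matrix_def invertible_det_nz)
qed

lemma column_Y_pos:
  assumes "t \<ge> 0"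
  shows "norm (column a (Y t)) > 0"
proof -
  have "column a (Y t) \<noteq> 0"
    using fundamental_Y assms det_zero_column[of a "Y t"]
    by (auto simp: fundamental_matrix_def invertible_det_nz)
  then show ?thesis by simp
qed

text \<open>By regularity, the volume of the columns in \<open>S\<close> grows at the rate \<open>sum \<mu> S\<close>.\<close>

lemma prod_columns_over_vol_tendsto_0:
  assumes "(\<Sum>b\<in>S. \<mu> (g b)) < sum \<mu> S"
  shows "((\<lambda>t. (\<Prod>b\<in>S. norm (column (g b) (Y t))) / vol S (Y t)) \<longlongrightarrow> 0) at_top"
proof -
  define f where "f b = (if b \<in> S then g b else b)" for b
  define gap where "gap = sum \<mu> S - (\<Sum>b\<in>S. \<mu> (g b))"
  \<comment> \<open>Chosen such that \<open>(CARD('n) + 1) * \<delta> = gap / 2\<close>: one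
    \<open>\<delta>\<close> for each column bound and one for the determinant.\<close>
  define \<delta> where "\<delta> = gap / (2 * (real CARD('n) + 1))"
  have gap: "gap > 0" using assms by (simp add: gap_def)
  then have \<delta>: "\<delta> > 0" by (simp add: \<delta>_def)
  let ?c = "(real CARD('n \<Rightarrow> 'n) * real CARD('n)) ^ card (- S)"
  have c: "?c > 0" by simp
  have sum_f: "(\<Sum>b\<in>UNIV. \<mu> (f b)) = sum \<mu> UNIV - gap"
  proof -
    have "(\<Sum>b\<in>UNIV. \<mu> (f b)) = (\<Sum>b\<in>S. \<mu> (g b)) + sum \<mu> (- S)"
      by (subst sum.subset_diff[of S UNIV]) (auto simp: f_def Compl_eq_Diff_UNIV)
    also have "sum \<mu> (- S) = sum \<mu> UNIV - sum \<mu> S"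
      by (subst sum.subset_diff[of S UNIV]) (auto simp: Compl_eq_Diff_UNIV)
    finally show ?thesis by (simp add: gap_def)
  qed
  have "eventually (\<lambda>t. \<forall>b\<in>UNIV. norm (column (f b) (Y t)) < exp ((\<mu> (f b) + \<delta>) * t)) at_top"
    using \<delta> by (intro eventually_ball_finite ballI column_upper) auto
  moreover have "eventually (\<lambda>t. exp ((sum \<mu> UNIV - \<delta>) * t) < \<bar>det (Y t)\<bar>) at_top"
    using \<delta> by (intro det_lower) auto
  ultimately have "eventually (\<lambda>t. norm ((\<Prod>b\<in>S. norm (column (g b) (Y t))) / vol S (Y t)) \<le>
      ?c * exp (- (gap / 2 * t))) at_top"
    using eventually_ge_at_top[of 0]
  proof eventually_elim
    case (elim t)
    let ?u = "\<lambda>b. norm (column b (Y t))"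
    have "prod ?u (- S) > 0"
      using column_Y_pos elim(3) by (intro prod_pos) auto
    have "(\<Prod>b\<in>S. ?u (g b)) * prod ?u (- S) = (\<Prod>b\<in>UNIV. ?u (f b))"
      by (subst prod.subset_diff[of S UNIV]) (auto simp: f_def Compl_eq_Diff_UNIV)
    also have "\<dots> \<le> (\<Prod>b\<in>UNIV. exp ((\<mu> (f b) + \<delta>) * t))"
      using elim(1) by (intro prod_mono) (auto intro: less_imp_le)
    also have "\<dots> = exp (((\<Sum>b\<in>UNIV. \<mu> (f b)) + real CARD('n) * \<delta>) * t)"
      by (simp add: sum.distrib flip: exp_sum sum_distrib_right)
    also have "\<dots> = exp (- (gap / 2 * t)) * exp ((sum \<mu> UNIV - \<delta>) * t)"
    proof -
      have "(real CARD('n) + 1) * \<delta> = gap / 2"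
        by (simp add: \<delta>_def field_simps)
      then have eq: "real CARD('n) * \<delta> = gap / 2 - \<delta>"
        by (simp add: algebra_simps)
      show ?thesis
        unfolding sum_f exp_add[symmetric] eq by (simp add: algebra_simps)
    qed
    also have "\<dots> \<le> exp (- (gap / 2 * t)) * (?c * prod ?u (- S) * vol S (Y t))"
      using elim(2) abs_det_le_vol_columns[of "Y t" S] by (intro mult_left_mono) auto
    finally have "(\<Prod>b\<in>S. ?u (g b)) \<le> ?c * exp (- (gap / 2 * t)) * vol S (Y t)"
      using \<open>prod ?u (- S) > 0\<close> by (simp add: mult_ac)
    then show ?case
      using vol_Y_pos[OF elim(3), of S]
      by (simp add: divide_le_eq abs_of_nonneg prod_nonneg)
  qed
  moreover have "((\<lambda>t. ?c * exp (- (gap / 2 * t))) \<longlongrightarrow> 0) at_top"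
  proof -
    have "filterlim (\<lambda>t. gap / 2 * t) at_top at_top"
      using gap by (intro filterlim_tendsto_pos_mult_at_top[OF tendsto_const _ filterlim_ident]) auto
    then have "((\<lambda>t. exp (- (gap / 2 * t))) \<longlongrightarrow> 0) at_top"
      by (intro filterlim_compose[OF exp_at_bot] filterlim_compose[OF filterlim_uminus_at_bot_at_top])
    then show ?thesis
      by (rule tendsto_mult_right_zero)
  qed
  ultimately show ?thesis
    by (rule Lim_null_comparison)
qed

text \<open>Repeated columns give 0, rearrangements of \<open>first L\<close> change only the sign,
  and any other set of columns has a strictly smaller sum of exponents, so that its minor is
  eventually dominated by the volume.\<close>

lemma minor_le_vol:
  assumes L: "L \<le> CARD('n)"
  shows "\<exists>C. \<forall>t\<ge>0. \<bar>minor (first L) h g (Y t)\<bar> \<le> C * vol (first L) (Y t)"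
proof -
  let ?S = "first L"
  consider "\<not> inj_on g ?S" | "inj_on g ?S" "g ` ?S = ?S" | "inj_on g ?S" "g ` ?S \<noteq> ?S"
    by blast
  then show ?thesis
  proof cases
    case 1
    then show ?thesis
      by (intro exI[of _ 0]) (simp add: minor_not_inj_cols)
  next
    case 2
    define p where "p a = (if a \<in> ?S then g a else a)" for a
    have "p permutes ?S"
      using 2 by (intro bij_imp_permutes) (auto simp: p_def bij_betw_def inj_on_def)
    then have "\<bar>minor ?S h (id \<circ> p) W\<bar> = \<bar>minor ?S h id W\<bar>" for W
      by (rule abs_minor_permuted_cols)
    moreover have "minor ?S h g W = minor ?S h (id \<circ> p) W" for W
      by (rule minor_cong) (auto simp: p_def)
    ultimately have "\<bar>minor ?S h g W\<bar> \<le> vol ?S W" for W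
      using abs_minor_le_vol[of ?S h W] by simp
    then show ?thesis
      by (intro exI[of _ 1]) simp
  next
    case 3
    have "(\<Sum>b\<in>?S. \<mu> (g b)) = sum \<mu> (g ` ?S)"
      using 3(1) by (simp add: sum.reindex)
    also have "\<dots> < sum \<mu> ?S"
      using 3 L by (intro sum_less_sum_first \<mu>_less) (auto simp: card_image card_first)
    finally have "((\<lambda>t. real CARD('n) ^ card ?S *
        ((\<Prod>b\<in>?S. norm (column (g b) (Y t))) / vol ?S (Y t))) \<longlongrightarrow> 0) at_top"
      by (intro tendsto_mult_right_zero prod_columns_over_vol_tendsto_0)
    then have "eventually (\<lambda>t. real CARD('n) ^ card ?S *
        ((\<Prod>b\<in>?S. norm (column (g b) (Y t))) / vol ?S (Y t)) < 1) at_top"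
      by (rule order_tendstoD) simp
    then have ev: "eventually (\<lambda>t. \<bar>minor ?S h g (Y t)\<bar> / vol ?S (Y t) \<le> 1) at_top"
      using eventually_ge_at_top[of 0]
    proof eventually_elim
      case (elim t)
      then show ?case
        using vol_Y_pos[of t ?S] abs_minor_le_prod_columns[of ?S h g "Y t"]
        by (simp add: divide_le_eq divide_less_eq)
    qed
    have "continuous_on {0..} (\<lambda>t. \<bar>minor ?S h g (Y t)\<bar> / vol ?S (Y t))"
      using vol_Y_pos continuous_on_fundamental_matrix[OF fundamental_Y]
      by (intro continuous_intros continuous_on_minor continuous_on_vol) (auto simp: less_imp_neq[symmetric])
    then obtain C where C: "\<And>t. t \<ge> 0 \<Longrightarrow> \<bar>minor ?S h g (Y t)\<bar> / vol ?S (Y t) \<le> C"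
      by (rule bounded_above_on_half_line[OF _ ev]) (rule that)
    then show ?thesis
      using vol_Y_pos[of _ ?S] by (intro exI[of _ C]) (simp add: divide_le_eq)
  qed
qed

lemma sum_minors_le_vol:
  assumes L: "L \<le> CARD('n)"
  shows "\<exists>C. \<forall>t\<ge>0. (\<Sum>h\<in>UNIV. \<Sum>g\<in>UNIV. \<bar>minor (first L) h g (Y t)\<bar>) \<le> C * vol (first L) (Y t)"
proof -
  obtain C where C: "\<And>h g t. t \<ge> 0 \<Longrightarrow>
      \<bar>minor (first L) h g (Y t)\<bar> \<le> C h g * vol (first L) (Y t)"
    using minor_le_vol[OF L] by metis
  show ?thesis
  proof (intro exI allI impI)
    fix t :: real assume "t \<ge> 0"
    then show "(\<Sum>h\<in>UNIV. \<Sum>g\<in>UNIV. \<bar>minor (first L) h g (Y t)\<bar>) \<le>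
        (\<Sum>h\<in>UNIV. \<Sum>g\<in>UNIV. C h g) * vol (first L) (Y t)"
      unfolding sum_distrib_right by (intro sum_mono C)
  qed
qed

text \<open>All minors of \<open>Y t\<close> are dominated by the leading volume, and the Cauchy
  matrix from time 0 differs from \<open>Y t\<close> by the constant factor
  \<open>matrix_inv (Y 0)\<close>.\<close>

lemma sv_prod_0_le_vol:
  assumes L: "L \<le> CARD('n)"
  shows "\<exists>C. \<forall>t\<ge>0. sv_prod L (cauchy_matrix Y t 0) \<le> C * vol (first L) (Y t)"
proof -
  obtain C where C: "\<And>t. t \<ge> 0 \<Longrightarrow>
      (\<Sum>h\<in>UNIV. \<Sum>g\<in>UNIV. \<bar>minor (first L) h g (Y t)\<bar>) \<le> C * vol (first L) (Y t)"
    using sum_minors_le_vol[OF L] by metis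
  obtain m where m: "m \<ge> 1" "\<And>i j. \<bar>matrix_inv (Y 0) $ i $ j\<bar> \<le> m"
    by (rule matrix_entries_bounded) (rule that)
  let ?c = "real CARD('n \<Rightarrow> 'n) * m ^ CARD('n)"
  have "sv_prod L (cauchy_matrix Y t 0) \<le> ?c * C * vol (first L) (Y t)" if t: "t \<ge> 0" for t
  proof -
    have "sv_prod L (cauchy_matrix Y t 0) \<le>
        (\<Sum>h\<in>UNIV. \<Sum>g\<in>UNIV. \<bar>minor (first L) h g (Y t ** matrix_inv (Y 0))\<bar>)"
      using sv_prod_le_minors[OF invertible_cauchy_matrix[OF fundamental_Y t order_refl] L]
      by (simp add: cauchy_matrix_def)
    also have "\<dots> \<le> (\<Sum>h\<in>UNIV. ?c * (\<Sum>g\<in>UNIV. \<bar>minor (first L) h g (Y t)\<bar>))"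
      by (intro sum_mono sum_abs_minor_mult_right_le m)
    also have "\<dots> = ?c * (\<Sum>h\<in>UNIV. \<Sum>g\<in>UNIV. \<bar>minor (first L) h g (Y t)\<bar>)"
      by (simp only: sum_distrib_left)
    also have "\<dots> \<le> ?c * (C * vol (first L) (Y t))"
      using C[OF t] m(1) by (intro mult_left_mono) auto
    finally show ?thesis by (simp add: mult_ac)
  qed
  then show ?thesis by blast
qed

section \<open>Volume growth along Cauchy matrices\<close>

lemma vol_Y_le:
  assumes "L \<le> CARD('n)" "t \<ge> 0" "s \<ge> 0"
  shows "vol (first L) (Y t) \<le>
    real CARD('n \<Rightarrow> 'n) ^ 2 * (sv_prod L (cauchy_matrix Y t s) * vol (first L) (Y s))"
  using vol_mult_le_sv_prod[OF invertible_cauchy_matrix[OF fundamental_Y assms(2,3)] assms(1), of "Y s"]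
  by (simp add: cauchy_matrix_mult[OF fundamental_Y assms(3)] mult_ac)

lemma strongly_fast_invertible_sv_prod:
  assumes "strongly_fast_invertible A L"
  shows "\<exists>C. \<forall>t s. s \<ge> 0 \<longrightarrow> t \<ge> s \<longrightarrow>
    sv_prod L (cauchy_matrix Y t s) * sv_prod L (cauchy_matrix Y s 0) / sv_prod L (cauchy_matrix Y t 0) \<le> C"
proof -
  obtain X where X: "fundamental_matrix A X"
    "bdd_above {(\<Prod>k = 1..L. singular_value k (cauchy_matrix X t s) * singular_value k (cauchy_matrix X s \<tau>)
             / singular_value k (cauchy_matrix X t \<tau>)) | t s \<tau>. t \<ge> s \<and> s \<ge> \<tau> \<and> \<tau> \<ge> 0}"
    using assms unfolding strongly_fast_invertible_def by blast
  then obtain C where C: "\<And>z. z \<in> {(\<Prod>k = 1..L. singular_value k (cauchy_matrix X t s) * singular_value k (cauchy_matrix X s \<tau>)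
             / singular_value k (cauchy_matrix X t \<tau>)) | t s \<tau>. t \<ge> s \<and> s \<ge> \<tau> \<and> \<tau> \<ge> 0} \<Longrightarrow> z \<le> C"
    unfolding bdd_above_def by blast
  have "sv_prod L (cauchy_matrix Y t s) * sv_prod L (cauchy_matrix Y s 0) / sv_prod L (cauchy_matrix Y t 0) \<le> C"
    if "s \<ge> 0" "t \<ge> s" for t s
  proof -
    have eq: "cauchy_matrix Y t s = cauchy_matrix X t s" "cauchy_matrix Y s 0 = cauchy_matrix X s 0"
      "cauchy_matrix Y t 0 = cauchy_matrix X t 0"
      using that by (auto intro!: cauchy_matrix_unique[OF bounded_A X(1) fundamental_Y])
    have "(\<Prod>k = 1..L. singular_value k (cauchy_matrix X t s) * singular_value k (cauchy_matrix X s 0)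
             / singular_value k (cauchy_matrix X t 0)) \<le> C"
      using that by (intro C) blast
    then show ?thesis
      unfolding eq sv_prod_def by (simp only: prod_dividef prod.distrib)
  qed
  then show ?thesis by blast
qed

text \<open>The counterpart of \<open>vol_Y_le\<close>. The volume at \<open>s\<close> is at most a
  multiple of \<open>?P s 0\<close>; fast invertibility bounds \<open>?P t s * ?P s 0\<close> by a
  multiple of \<open>?P t 0\<close>, hence of the volume at \<open>t\<close>.\<close>

lemma sv_prod_vol_le:
  assumes fast: "\<And>L. L \<in> {1..CARD('n)} \<Longrightarrow> strongly_fast_invertible A L" and L: "L \<le> CARD('n)"
  shows "\<exists>C. \<forall>t s. s \<ge> 0 \<longrightarrow> t \<ge> s \<longrightarrow>
    sv_prod L (cauchy_matrix Y t s) * vol (first L) (Y s) \<le> C * vol (first L) (Y t)"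
proof (cases "L = 0")
  \<comment> \<open>Both sides are constant here. The case is used below with \<open>k = 0\<close>
    and \<open>m = 0\<close>, which \<open>fast\<close> does not cover.\<close>
  case True
  then show ?thesis
    by (intro exI[of _ 1]) (simp add: sv_prod_def vol_def)
next
  case False
  let ?K = "real CARD('n \<Rightarrow> 'n) ^ 2"
  let ?P = "\<lambda>t s. sv_prod L (cauchy_matrix Y t s)"
  obtain C where C: "\<And>t s. s \<ge> 0 \<Longrightarrow> t \<ge> s \<Longrightarrow> ?P t s * ?P s 0 / ?P t 0 \<le> C"
    using strongly_fast_invertible_sv_prod[OF fast[of L]] False L by auto
  obtain C' where C': "\<And>t. t \<ge> 0 \<Longrightarrow> ?P t 0 \<le> C' * vol (first L) (Y t)"
    using sv_prod_0_le_vol[OF L] by blast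
  have P: "?P t s > 0" if "t \<ge> 0" "s \<ge> 0" for t s
    using sv_prod_pos[OF invertible_cauchy_matrix[OF fundamental_Y that] L] .
  have "C \<ge> 0"
    using C[of 0 0] P[of 0 0] by (auto intro: order_trans[OF _ C[of 0 0]])
  have "?P t s * vol (first L) (Y s) \<le> ?K * C * C' * vol (first L) (Y 0) * vol (first L) (Y t)"
    if ts: "s \<ge> 0" "t \<ge> s" for t s
  proof -
    have "?P t s * vol (first L) (Y s) \<le> ?P t s * (?K * (?P s 0 * vol (first L) (Y 0)))"
      using vol_Y_le[OF L ts(1), of 0] P[of t s] ts by (intro mult_left_mono) auto
    also have "\<dots> = ?K * vol (first L) (Y 0) * (?P t s * ?P s 0)"
      by simp
    also have "\<dots> \<le> ?K * vol (first L) (Y 0) * (C * ?P t 0)"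
      using C[OF ts] P[of t 0] ts by (intro mult_left_mono) (auto simp: divide_le_eq)
    also have "\<dots> \<le> ?K * vol (first L) (Y 0) * (C * (C' * vol (first L) (Y t)))"
      using C'[of t] ts \<open>C \<ge> 0\<close> by (intro mult_left_mono) auto
    finally show ?thesis by (simp add: mult_ac)
  qed
  then show ?thesis by blast
qed

text \<open>The angle bound: \<open>column_le_vol_quotient\<close> is applied to the Cauchy matrix
  from \<open>t\<close> to \<open>T\<close> and to \<open>Y t\<close>, with \<open>growth\<close>
  supplied by \<open>sv_prod_vol_le\<close>.\<close>

lemma column_vol_le:
  assumes fast: "\<And>L. L \<in> {1..CARD('n)} \<Longrightarrow> strongly_fast_invertible A L" and m: "Suc m \<le> CARD('n)"
  shows "\<exists>C. \<forall>t\<ge>0. norm (column (e (Suc m)) (Y t)) * vol (first m) (Y t) \<le> C * vol (first (Suc m)) (Y t)"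
proof (cases m)
  \<comment> \<open>A single column has no angle to control; its entries are minors of size
    1.\<close>
  case 0
  let ?K = "real CARD('n \<Rightarrow> 'n)"
  let ?l = "e (Suc 0)"
  have "norm (column ?l W) * vol {} W \<le> real CARD('n) * ?K * vol (insert ?l {}) W" for W
  proof -
    have "\<bar>column ?l W $ i\<bar> \<le> vol (insert ?l {}) W" for i
      using abs_minor_le_vol[of "insert ?l {}" "\<lambda>_. i" W]
      by (subst (asm) minor_insert_col) (auto simp: column_def)
    then have "norm (column ?l W) \<le> (\<Sum>i\<in>(UNIV :: 'n set). vol (insert ?l {}) W)"
      by (intro order_trans[OF norm_le_l1_cart] sum_mono)
    then show ?thesis
      by (simp add: vol_def[of "{}"] mult.commute mult_left_mono)
  qed
  then show ?thesis
    unfolding 0 first_Suc first_0 by blast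
next
  case (Suc k)
  let ?l = "e (Suc (Suc k))"
  let ?v1 = "\<lambda>t. vol (first k) (Y t)"
  let ?v2 = "\<lambda>t. vol (first (Suc k)) (Y t)"
  let ?v3 = "\<lambda>t. vol (first (Suc (Suc k))) (Y t)"
  let ?n = "\<lambda>t. norm (column ?l (Y t))"
  let ?M = "\<lambda>T t. cauchy_matrix Y T t"
  have k: "Suc (Suc k) \<le> CARD('n)" using m Suc by simp
  obtain q where q: "\<And>T t. t \<ge> 0 \<Longrightarrow> T \<ge> t \<Longrightarrow> sv_prod (Suc k) (?M T t) * ?v2 t \<le> q * ?v2 T"
    using sv_prod_vol_le[OF fast, of "Suc k"] k by auto
  obtain q' where q': "\<And>T t. t \<ge> 0 \<Longrightarrow> T \<ge> t \<Longrightarrow> sv_prod k (?M T t) * ?v1 t \<le> q' * ?v1 T"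
    using sv_prod_vol_le[OF fast, of k] k by auto
  have pos: "sv_prod L (?M T t) > 0" if "0 \<le> t" "t \<le> T" "L \<le> CARD('n)" for L T t
    using that by (intro sv_prod_pos invertible_cauchy_matrix[OF fundamental_Y]) auto
  have "0 < sv_prod (Suc k) (?M 0 0) * ?v2 0"
    using pos[of 0 0 "Suc k"] vol_Y_pos[of 0 "first (Suc k)"] k by (intro mult_pos_pos) auto
  also have "\<dots> \<le> q * ?v2 0"
    by (rule q) simp_all
  finally have "q > 0"
    by (rule zero_less_mult_pos2) (simp add: vol_Y_pos)
  let ?C = "real CARD('n) ^ 2 * real CARD('n \<Rightarrow> 'n) ^ 6"
  have "?n t * ?v2 t \<le> ?C * q * ?v3 t" if t: "t \<ge> 0" for t
  proof -
    \<comment> \<open>The quotient of the two products is the reciprocal of the singular value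
      number \<open>Suc k\<close>.\<close>
    define r where "r T = ?n T * sv_prod k (?M T t) / sv_prod (Suc k) (?M T t)" for T
    define K where "K = real CARD('n \<Rightarrow> 'n) ^ 2"
    \<comment> \<open>Depends on \<open>t\<close> but not on \<open>T\<close>, so it does not affect
      the limit.\<close>
    define b where "b = q' * K * ?v2 t / ?v1 t"
    \<comment> \<open>Replaces the last of the first \<open>Suc k\<close> columns by the slower
      column \<open>?l\<close>; the drop in exponents makes the product of lengths negligible
      against \<open>?v2\<close>.\<close>
    define g where "g = (\<lambda>a. if a = e (Suc k) then ?l else a)"
    have eS: "e (Suc k) \<notin> first k"
      using k by (subst e_in_first_iff) auto
    have r_le: "r T \<le> b * (?n T * ?v1 T / ?v2 T)" if T: "T \<ge> t" for T
    proof -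
      have v: "?v1 t > 0" "?v2 t > 0" "?v1 T > 0" "?v2 T > 0"
        using t T by (auto intro: vol_Y_pos)
      have P: "sv_prod (Suc k) (?M T t) > 0" "sv_prod k (?M T t) > 0"
        using pos[of t T] t T k by auto
      have "0 \<le> q' * ?v1 T"
        using q'[OF t T] mult_pos_pos[OF P(2) v(1)] by linarith
      then have "(sv_prod k (?M T t) * ?v1 t) * ?v2 T \<le>
          (q' * ?v1 T) * (K * (sv_prod (Suc k) (?M T t) * ?v2 t))"
        unfolding K_def using vol_Y_le[of "Suc k" T t] t T k v
        by (intro mult_mono'[OF q'[OF t T]]) (auto intro!: mult_nonneg_nonneg simp: P less_imp_le)
      then have "sv_prod k (?M T t) / sv_prod (Suc k) (?M T t) \<le> b * (?v1 T / ?v2 T)"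
        using v P by (simp add: b_def field_simps)
      then have "?n T * (sv_prod k (?M T t) / sv_prod (Suc k) (?M T t)) \<le> ?n T * (b * (?v1 T / ?v2 T))"
        by (intro mult_left_mono) auto
      then show ?thesis by (simp add: r_def mult_ac)
    qed
    have v1_le: "?n T * ?v1 T \<le> real CARD('n \<Rightarrow> 'n) * real CARD('n) ^ card (first k) *
        (\<Prod>b\<in>first (Suc k). norm (column (g b) (Y T)))" for T
    proof -
      have "?v1 T \<le> (\<Sum>h\<in>(UNIV::('n \<Rightarrow> 'n) set). real CARD('n) ^ card (first k) *
          (\<Prod>b\<in>first k. norm (column (id b) (Y T))))"
        unfolding vol_def by (intro sum_mono abs_minor_le_prod_columns)
      then have "?n T * ?v1 T \<le> ?n T * (real CARD('n \<Rightarrow> 'n) * (real CARD('n) ^ card (first k) *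
          (\<Prod>b\<in>first k. norm (column b (Y T)))))"
        by (intro mult_left_mono) (simp_all del: card_fun)
      moreover have "(\<Prod>b\<in>first (Suc k). norm (column (g b) (Y T))) =
          ?n T * (\<Prod>b\<in>first k. norm (column b (Y T)))"
        unfolding first_Suc using eS
        by (subst prod.insert) (auto simp: g_def intro!: arg_cong2[where f = times] prod.cong)
      ultimately show ?thesis
        by (simp add: mult_ac del: card_fun)
    qed
    have "(\<Sum>b\<in>first (Suc k). \<mu> (g b)) < sum \<mu> (first (Suc k))"
    proof -
      have "(\<Sum>b\<in>first k. \<mu> (g b)) = sum \<mu> (first k)"
        using eS by (intro sum.cong) (auto simp: g_def)
      then show ?thesis
        unfolding first_Suc using eS \<mu>_less[of "Suc k" "Suc (Suc k)"] k by (simp add: g_def)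
    qed
    from tendsto_mult_right_zero[OF prod_columns_over_vol_tendsto_0[OF this]]
    have lim0: "((\<lambda>T. c * ((\<Prod>b\<in>first (Suc k). norm (column (g b) (Y T))) / ?v2 T)) \<longlongrightarrow> 0) at_top"
      for c by blast
    \<comment> \<open>The absolute value avoids a sign condition on \<open>q'\<close>.\<close>
    let ?\<rho> = "\<lambda>T. \<bar>b\<bar> * (real CARD('n \<Rightarrow> 'n) * real CARD('n) ^ card (first k)) *
        ((\<Prod>b\<in>first (Suc k). norm (column (g b) (Y T))) / ?v2 T)"
    have r_\<rho>: "r T \<le> ?\<rho> T" if T: "T \<ge> t" for T
    proof -
      have v: "?v1 T > 0" "?v2 T > 0"
        using t T by (auto intro: vol_Y_pos)
      have "r T \<le> b * (?n T * ?v1 T / ?v2 T)"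
        by (rule r_le[OF T])
      also have "\<dots> \<le> \<bar>b\<bar> * (?n T * ?v1 T / ?v2 T)"
        using v by (intro mult_right_mono) auto
      also have "\<dots> \<le> \<bar>b\<bar> * (real CARD('n \<Rightarrow> 'n) * real CARD('n) ^ card (first k) *
        (\<Prod>b\<in>first (Suc k). norm (column (g b) (Y T))) / ?v2 T)"
        using v v1_le[of T] by (intro mult_left_mono divide_right_mono) auto
      finally show ?thesis by (simp add: mult_ac del: card_fun)
    qed
    have bound: "?n t * ?v2 t \<le> ?C * q * (?v3 t + q * ?\<rho> T * ?v2 t)" if T: "T \<ge> t" for T
    proof -
      have "?n t * ?v2 t \<le> ?C * q * (?v3 t + q * r T * ?v2 t)"
        using column_le_vol_quotient[of "?M T t" k "Y t" q] q[OF t T] t T k \<open>q > 0\<close>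
          invertible_cauchy_matrix[OF fundamental_Y, of T t] vol_Y_pos[OF t, of "first (Suc k)"]
        unfolding cauchy_matrix_mult[OF fundamental_Y t] r_def by simp
      also have "\<dots> \<le> ?C * q * (?v3 t + q * ?\<rho> T * ?v2 t)"
        using r_\<rho>[OF T] \<open>q > 0\<close>
        by (intro mult_left_mono add_left_mono mult_right_mono) auto
      finally show ?thesis .
    qed
    \<comment> \<open>As \<open>T\<close> grows with \<open>t\<close> fixed, the error term vanishes
      and leaves the constant \<open>?C * q\<close>, independent of \<open>t\<close>.\<close>
    have "((\<lambda>T. ?C * q * (?v3 t + q * ?\<rho> T * ?v2 t)) \<longlongrightarrow> ?C * q * (?v3 t + q * 0 * ?v2 t)) at_top"
      by (intro tendsto_intros lim0)
    moreover have "eventually (\<lambda>T. ?n t * ?v2 t \<le> ?C * q * (?v3 t + q * ?\<rho> T * ?v2 t)) at_top"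
      using eventually_ge_at_top[of t] by eventually_elim (rule bound)
    ultimately have "?n t * ?v2 t \<le> ?C * q * (?v3 t + q * 0 * ?v2 t)"
      by (rule tendsto_lowerbound) simp
    then show ?thesis by simp
  qed
  then show ?thesis
    unfolding Suc by blast
qed

text \<open>Unprimed values belong to time \<open>s\<close>, primed ones to \<open>t\<close>:
  \<open>a\<close> is the length of a column, \<open>v\<close> and \<open>w\<close> are the volumes
  without and with it, \<open>P\<close> and \<open>Q\<close> the products of singular values. Each
  chain uses four comparisons, hence \<open>C ^ 4\<close>.\<close>

lemma quotient_estimate:
  fixes C a a' v v' w w' P Q \<sigma> :: real
  assumes pos: "C > 0" "a > 0" "a' > 0" "v > 0" "v' > 0" "w > 0" "w' > 0" "P > 0" "Q > 0"
    and Q: "Q = P * \<sigma>"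
    and 1: "a * v \<le> C * w" and 2: "w \<le> C * (a * v)"
    and 3: "a' * v' \<le> C * w'" and 4: "w' \<le> C * (a' * v')"
    and 5: "P * v \<le> C * v'" and 6: "v' \<le> C * (P * v)"
    and 7: "Q * w \<le> C * w'" and 8: "w' \<le> C * (Q * w)"
  shows "\<sigma> \<le> C ^ 4 * (a' / a)" "a' / a \<le> C ^ 4 * \<sigma>"
proof -
  have "Q * (a * v) \<le> Q * (C * w)"
    using 1 pos by (intro mult_left_mono) auto
  also have "\<dots> = C * (Q * w)" by simp
  also have "\<dots> \<le> C * (C * w')"
    using 7 pos by (intro mult_left_mono) auto
  also have "\<dots> \<le> C * (C * (C * (a' * v')))"
    using 4 pos by (intro mult_left_mono) auto
  also have "\<dots> \<le> C * (C * (C * (a' * (C * (P * v)))))"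
    using 6 pos by (intro mult_left_mono) auto
  finally have "(\<sigma> * a) * (P * v) \<le> (C ^ 4 * a') * (P * v)"
    by (simp add: Q eval_nat_numeral mult_ac)
  then have "\<sigma> * a \<le> C ^ 4 * a'"
    by (rule mult_right_le_imp_le) (use pos in simp)
  then show "\<sigma> \<le> C ^ 4 * (a' / a)"
    using pos by (simp add: pos_le_divide_eq)
  have "a' * (P * v) \<le> a' * (C * v')"
    using 5 pos by (intro mult_left_mono) auto
  also have "\<dots> = C * (a' * v')" by simp
  also have "\<dots> \<le> C * (C * w')"
    using 3 pos by (intro mult_left_mono) auto
  also have "\<dots> \<le> C * (C * (C * (Q * w)))"
    using 8 pos by (intro mult_left_mono) auto
  also have "\<dots> \<le> C * (C * (C * (Q * (C * (a * v)))))"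
    using 2 pos by (intro mult_left_mono) auto
  finally have "a' * (P * v) \<le> (C ^ 4 * (\<sigma> * a)) * (P * v)"
    by (simp add: Q eval_nat_numeral mult_ac)
  then have "a' \<le> C ^ 4 * (\<sigma> * a)"
    by (rule mult_right_le_imp_le) (use pos in simp)
  then show "a' / a \<le> C ^ 4 * \<sigma>"
    using pos by (simp add: pos_divide_le_eq mult_ac)
qed

lemma column_ratio_singular_value:
  assumes fast: "\<And>L. L \<in> {1..CARD('n)} \<Longrightarrow> strongly_fast_invertible A L"
    and i: "i \<in> {1..CARD('n)}"
  shows "\<exists>c>0. \<forall>t s. s \<ge> 0 \<longrightarrow> t \<ge> s \<longrightarrow>
    singular_value i (cauchy_matrix Y t s) \<le>
      c * (norm (column (e i) (Y t)) / norm (column (e i) (Y s))) \<and>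
    norm (column (e i) (Y t)) / norm (column (e i) (Y s)) \<le>
      c * singular_value i (cauchy_matrix Y t s)"
proof -
  obtain m where m: "i = Suc m" "Suc m \<le> CARD('n)"
    using i by (cases i) auto
  let ?a = "\<lambda>t. norm (column (e i) (Y t))"
  let ?v = "\<lambda>t. vol (first m) (Y t)"
  let ?w = "\<lambda>t. vol (first (Suc m)) (Y t)"
  let ?P = "\<lambda>t s. sv_prod m (cauchy_matrix Y t s)"
  let ?Q = "\<lambda>t s. sv_prod (Suc m) (cauchy_matrix Y t s)"
  let ?s = "\<lambda>t s. singular_value i (cauchy_matrix Y t s)"
  obtain C1 where C1: "\<And>t. t \<ge> 0 \<Longrightarrow> ?a t * ?v t \<le> C1 * ?w t"
    using column_vol_le[OF fast m(2)] m(1) by auto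
  define C2 where "C2 = real CARD('n \<Rightarrow> 'n) * real CARD('n)"
  have C2: "?w t \<le> C2 * ?a t * ?v t" for t
    unfolding C2_def m(1) first_Suc using m(2)
    by (intro vol_insert_le) (subst e_in_first_iff, auto)
  obtain C3 where C3: "\<And>t s. s \<ge> 0 \<Longrightarrow> t \<ge> s \<Longrightarrow> ?P t s * ?v s \<le> C3 * ?v t"
    using sv_prod_vol_le[OF fast, of m] m(2) by auto
  obtain C4 where C4: "\<And>t s. s \<ge> 0 \<Longrightarrow> t \<ge> s \<Longrightarrow> ?Q t s * ?w s \<le> C4 * ?w t"
    using sv_prod_vol_le[OF fast, of "Suc m"] m(2) by auto
  \<comment> \<open>One constant serves all comparisons; the entry 1 keeps it positive.\<close>
  define C where "C = Max {1, C1, C2, C3, C4, real CARD('n \<Rightarrow> 'n) ^ 2}"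
  have C: "C \<ge> 1" "C1 \<le> C" "C2 \<le> C" "C3 \<le> C" "C4 \<le> C" "real CARD('n \<Rightarrow> 'n) ^ 2 \<le> C"
    unfolding C_def by (auto intro!: Max_ge)
  show ?thesis
  proof (intro exI[of _ "C ^ 4"] conjI allI impI)
    show "C ^ 4 > 0" using C(1) by simp
    fix t s :: real assume s: "s \<ge> 0" and ts: "t \<ge> s"
    then have t: "t \<ge> 0" by simp
    have a: "?a t > 0" "?a s > 0" and v: "?v t > 0" "?v s > 0" and w: "?w t > 0" "?w s > 0"
      using s t by (auto intro: vol_Y_pos simp only: column_Y_pos)
    have P: "?P t s > 0" "?Q t s > 0"
      using sv_prod_pos[OF invertible_cauchy_matrix[OF fundamental_Y t s]] m(2) by auto
    have Q: "?Q t s = ?P t s * ?s t s"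
      using m(1) by (simp add: sv_prod_def)
    have up: "?a x * ?v x \<le> C * ?w x" "?w x \<le> C * (?a x * ?v x)" if "x \<in> {s, t}" for x
    proof -
      have x: "x \<ge> 0" using that s t by auto
      have "C1 * ?w x \<le> C * ?w x"
        using C(2) vol_nonneg by (rule mult_right_mono)
      then show "?a x * ?v x \<le> C * ?w x"
        using C1[OF x] by simp
      have "C2 * (?a x * ?v x) \<le> C * (?a x * ?v x)"
        using C(3) by (rule mult_right_mono) simp
      then show "?w x \<le> C * (?a x * ?v x)"
        using C2[of x] by simp
    qed
    have vP: "?P t s * ?v s \<le> C * ?v t" "?v t \<le> C * (?P t s * ?v s)"
    proof -
      have "C3 * ?v t \<le> C * ?v t" "real CARD('n \<Rightarrow> 'n) ^ 2 * (?P t s * ?v s) \<le> C * (?P t s * ?v s)"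
        using v P by (intro mult_right_mono C; simp)+
      then show "?P t s * ?v s \<le> C * ?v t" "?v t \<le> C * (?P t s * ?v s)"
        using C3[OF s ts] vol_Y_le[of m t s] m(2) s t by linarith+
    qed
    have wQ: "?Q t s * ?w s \<le> C * ?w t" "?w t \<le> C * (?Q t s * ?w s)"
    proof -
      have "C4 * ?w t \<le> C * ?w t" "real CARD('n \<Rightarrow> 'n) ^ 2 * (?Q t s * ?w s) \<le> C * (?Q t s * ?w s)"
        using w P by (intro mult_right_mono C; simp)+
      then show "?Q t s * ?w s \<le> C * ?w t" "?w t \<le> C * (?Q t s * ?w s)"
        using C4[OF s ts] vol_Y_le[of "Suc m" t s] m(2) s t by linarith+
    qed
    show "?s t s \<le> C ^ 4 * (?a t / ?a s)" "?a t / ?a s \<le> C ^ 4 * ?s t s"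
      by (rule quotient_estimate[OF _ a(2,1) v(2,1) w(2,1) P Q up(1)[of s] up(2)[of s]
            up(1)[of t] up(2)[of t] vP wQ]; use C(1) in simp)+
  qed
qed

lemma column_ratio_antimono:
  assumes fast: "\<And>L. L \<in> {1..CARD('n)} \<Longrightarrow> strongly_fast_invertible A L"
    and i: "i \<in> {1..CARD('n) - 1}"
  shows "\<exists>b>0. \<forall>t s. s \<ge> 0 \<longrightarrow> t \<ge> s \<longrightarrow>
    b * (norm (column (e (i + 1)) (Y t)) / norm (column (e (i + 1)) (Y s))) \<le>
    norm (column (e i) (Y t)) / norm (column (e i) (Y s))"
proof -
  let ?r = "\<lambda>i t s. norm (column (e i) (Y t)) / norm (column (e i) (Y s))"
  let ?s = "\<lambda>i t s. singular_value i (cauchy_matrix Y t s)"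
  have i1: "i \<in> {1..CARD('n)}" and i2: "i + 1 \<in> {1..CARD('n)}"
    using i by auto
  obtain c where c: "c > 0" "\<And>t s. s \<ge> 0 \<Longrightarrow> t \<ge> s \<Longrightarrow> ?s i t s \<le> c * ?r i t s"
    using column_ratio_singular_value[OF fast i1] by blast
  obtain d where d: "d > 0" "\<And>t s. s \<ge> 0 \<Longrightarrow> t \<ge> s \<Longrightarrow> ?r (i + 1) t s \<le> d * ?s (i + 1) t s"
    using column_ratio_singular_value[OF fast i2] by blast
  show ?thesis
  proof (intro exI[of _ "1 / (c * d)"] conjI allI impI)
    show "1 / (c * d) > 0" using c d by simp
    fix t s :: real assume s: "s \<ge> 0" and ts: "t \<ge> s"
    have "?s (i + 1) t s \<le> ?s i t s"
      using s ts i by (intro singular_value_antimono invertible_cauchy_matrix[OF fundamental_Y]) auto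
    then have "?r (i + 1) t s \<le> d * (c * ?r i t s)"
      using d(2)[OF s ts] c(2)[OF s ts] d(1)
      by (meson mult_left_mono order_trans less_imp_le)
    then have "1 / (c * d) * ?r (i + 1) t s \<le> 1 / (c * d) * (d * (c * ?r i t s))"
      using c(1) d(1) by (intro mult_left_mono) auto
    also have "\<dots> = ?r i t s"
      using c(1) d(1) by simp
    finally show "1 / (c * d) * ?r (i + 1) t s \<le> ?r i t s" .
  qed
qed

end

theorem theorem3p37:
  fixes A :: "real \<Rightarrow> real^'n^'n" and e :: "nat \<Rightarrow> 'n"
  assumes "continuous_on {0..} A"
    and "bounded (A ` {0..})"
    and "regular_system A"
    and "simple_spectrum A"
    and "\<And>L. L \<in> {1..CARD('n)} \<Longrightarrow> strongly_fast_invertible A L"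
    and "bij_betw e {1..CARD('n)} UNIV" \<comment> \<open>numbers the columns of a matrix\<close>
  shows "\<exists>X b. fundamental_matrix A X \<and> b > 0 \<and>
    (\<forall>t s. t \<ge> s \<and> s \<ge> 0 \<longrightarrow> (\<forall>i\<in>{1..CARD('n) - 1}.
       norm (column (e i) (X t)) / norm (column (e i) (X s)) \<ge>
       b * (norm (column (e (i + 1)) (X t)) / norm (column (e (i + 1)) (X s)))))"
proof -
  obtain Y \<mu> where Y: "fundamental_matrix A Y"
    "\<And>k l. 1 \<le> k \<Longrightarrow> k < l \<Longrightarrow> l \<le> CARD('n) \<Longrightarrow> \<mu> (e l) < \<mu> (e k)"
    "\<And>a \<nu>. \<mu> a < \<nu> \<Longrightarrow> eventually (\<lambda>t. norm (column a (Y t)) < exp (\<nu> * t)) at_top"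
    "\<And>\<nu>. \<nu> < sum \<mu> UNIV \<Longrightarrow> eventually (\<lambda>t. exp (\<nu> * t) < \<bar>det (Y t)\<bar>) at_top"
    by (rule regular_normal_basis[OF assms(2,3,4,6)]) (rule that)
  interpret normal_system e A Y \<mu>
    by unfold_locales (use assms(2,6) Y in auto)
  let ?r = "\<lambda>i t s. norm (column (e i) (Y t)) / norm (column (e i) (Y s))"
  have "\<forall>i\<in>{1..CARD('n) - 1}. \<exists>b>0. \<forall>t s. s \<ge> 0 \<longrightarrow> t \<ge> s \<longrightarrow> b * ?r (i + 1) t s \<le> ?r i t s"
    using column_ratio_antimono[OF assms(5)] by blast
  then obtain b where b: "\<And>i. i \<in> {1..CARD('n) - 1} \<Longrightarrow> b i > 0"
    "\<And>i t s. i \<in> {1..CARD('n) - 1} \<Longrightarrow> s \<ge> 0 \<Longrightarrow> t \<ge> s \<Longrightarrow> b i * ?r (i + 1) t s \<le> ?r i t s"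
    by metis
  \<comment> \<open>The inserted 1 keeps the minimum defined in dimension 1, where no index
    \<open>i\<close> exists.\<close>
  define B where "B = Min (insert 1 (b ` {1..CARD('n) - 1}))"
  have "B > 0"
    using b(1) by (auto simp: B_def Min_gr_iff)
  have B_le: "B \<le> b i" if "i \<in> {1..CARD('n) - 1}" for i
    using that unfolding B_def by (intro Min_le) auto
  have "B * ?r (i + 1) t s \<le> ?r i t s" if "t \<ge> s" "s \<ge> 0" "i \<in> {1..CARD('n) - 1}" for i t s
    using b(2)[OF that(3,2,1)] mult_right_mono[OF B_le[OF that(3)], of "?r (i + 1) t s"]
    by (auto intro: order_trans)
  then show ?thesis
    using Y(1) \<open>B > 0\<close> by blast
qed

end
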